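(* Let $G$ be a countable group and let $L$ be a Haagerup function on $G$. (1) If $G$ has polynomial H-growth with respect to $L$, then there exists $q\in\mathbb{N}$ such that, for every normalized 2-cocycle $\sigma$, the net $\{(1+tL)^{-q}\}_{t\to0^+}$ is a bounded Fourier summing net for $(G,\sigma)$. (2) If $G$ has subexponential H-growth with respect to $L$, then for every normalized 2-cocycle $\sigma$ the net $\{r^L\}_{r\to1^-}$ is a bounded Fourier summing net for $(G,\sigma)$.
   Context: A Haagerup function on $G$ is a negative definite function $h:G\to[0,\infty)$ which is proper ($h^{-1}([0,t])$ finite for all $t\ge0$); here negative definite means $e^{-th}$ is positive definite for all $t>0$. $\sigma:G\times G\to\mathbb{T}$ is a normalized 2-cocycle ($\sigma(g,h)\sigma(gh,k)=\sigma(h,k)\sigma(g,hk)$, $\sigma(g,e)=\sigma(e,g)=1$); $\Lambda_\sigma(g)$ is the unitary on $\ell^2(G)$ with $(\Lambda_\sigma(g)\xi)(h)=\sigma(g,g^{-1}h)\xi(g^{-1}h)$, $\lambda=\Lambda_1$; $C^*_r(G,\sigma)$ is the operator-norm closure of $\mathrm{span}\,\Lambda_\sigma(G)$; $\widehat x=x\delta_e$. $\mathcal{K}(G)$ = finitely supported functions, $\pi_\lambda(f)=\sum_g f(g)\lambda(g)$. Haagerup content of finite nonempty $E$: $c(E)=\sup\{\|\pi_\lambda(f)\|\mid \mathrm{supp}f\subseteq E,\ \|f\|_2=1\}$. With $B_{r,L}=\{g\mid L(g)\le r\}$: polynomial H-growth w.r.t. $L$ means $c(B_{r,L})\le K(1+r)^p$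 for some $K,p>0$ and all $r\ge0$; subexponential H-growth means for every $b>1$ there is $r_0$ with $c(B_{r,L})<b^r$ for all $r\ge r_0$. For $\varphi:G\to\mathbb{C}$, $M_\varphi$ is the linear map with $M_\varphi(\Lambda_\sigma(g))=\varphi(g)\Lambda_\sigma(g)$ (extended to $C^*_r(G,\sigma)$ when bounded). $MCF(G,\sigma)$ = set of $\varphi$ with $\sum_g\varphi(g)\widehat x(g)\Lambda_\sigma(g)$ norm-convergent for all $x\in C^*_r(G,\sigma)$. A Fourier summing net for $(G,\sigma)$ is a net in $MCF(G,\sigma)$ with $M_{\varphi_\alpha}(x)\to x$ in norm for all $x$; bounded means $\sup_\alpha\|M_{\varphi_\alpha}\|<\infty$. *)

theory Defs
  imports "HOL-Analysis.Analysis"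
begin

text \<open>The group G is a type of class group_add (written additively: e = 0, g h = g + h,
  g^-1 = - g), countable.  Vectors in l2(G) are functions G => complex; operators are
  functions on such vectors, only their behaviour on l2(G) matters.\<close>

definition l2 :: "('g \<Rightarrow> complex) set" where
  "l2 = {\<xi>. (\<lambda>g. (cmod (\<xi> g))\<^sup>2) summable_on UNIV}"

definition l2norm :: "('g \<Rightarrow> complex) \<Rightarrow> real" where
  "l2norm \<xi> = sqrt (infsum (\<lambda>g. (cmod (\<xi> g))\<^sup>2) UNIV)"

definition bounded_op :: "(('g \<Rightarrow> complex) \<Rightarrow> ('g \<Rightarrow> complex)) \<Rightarrow> bool" where
  "bounded_op T \<longleftrightarrow>
     (\<forall>\<xi>\<in>l2. T \<xi> \<in> l2) \<and>
     (\<forall>\<xi>\<in>l2. \<forall>\<eta>\<in>l2. T (\<lambda>g. \<xi> g + \<eta> g) = (\<lambda>g. T \<xi> g + T \<eta> g)) \<and>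
     (\<forall>\<xi>\<in>l2. \<forall>c::complex. T (\<lambda>g. c * \<xi> g) = (\<lambda>g. c * T \<xi> g)) \<and>
     (\<exists>C. \<forall>\<xi>\<in>l2. l2norm (T \<xi>) \<le> C * l2norm \<xi>)"

text \<open>Operator norm (meaningful for bounded operators).\<close>
definition opnorm :: "(('g \<Rightarrow> complex) \<Rightarrow> ('g \<Rightarrow> complex)) \<Rightarrow> real" where
  "opnorm T = Sup {l2norm (T \<xi>) | \<xi>. \<xi> \<in> l2 \<and> l2norm \<xi> \<le> 1}"

definition op_diff ::
  "(('g \<Rightarrow> complex) \<Rightarrow> ('g \<Rightarrow> complex)) \<Rightarrow> (('g \<Rightarrow> complex) \<Rightarrow> ('g \<Rightarrow> complex))
     \<Rightarrow> (('g \<Rightarrow> complex) \<Rightarrow> ('g \<Rightarrow> complex))" where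
  "op_diff S T = (\<lambda>\<xi> h. S \<xi> h - T \<xi> h)"

definition normalized_2cocycle :: "('g::group_add \<Rightarrow> 'g \<Rightarrow> complex) \<Rightarrow> bool" where
  "normalized_2cocycle \<sigma> \<longleftrightarrow>
     (\<forall>g h. cmod (\<sigma> g h) = 1) \<and>
     (\<forall>g h k. \<sigma> g h * \<sigma> (g + h) k = \<sigma> h k * \<sigma> g (h + k)) \<and>
     (\<forall>g. \<sigma> g 0 = 1 \<and> \<sigma> 0 g = 1)"

definition Lambda ::
  "('g::group_add \<Rightarrow> 'g \<Rightarrow> complex) \<Rightarrow> 'g \<Rightarrow> ('g \<Rightarrow> complex) \<Rightarrow> ('g \<Rightarrow> complex)" where
  "Lambda \<sigma> g \<xi> = (\<lambda>h. \<sigma> g (- g + h) * \<xi> (- g + h))"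

text \<open>pi_sigma(f) = sum_g f(g) Lambda_sigma(g) for finitely supported f (support given by F).\<close>
definition pi_op ::
  "('g::group_add \<Rightarrow> 'g \<Rightarrow> complex) \<Rightarrow> 'g set \<Rightarrow> ('g \<Rightarrow> complex) \<Rightarrow> ('g \<Rightarrow> complex) \<Rightarrow> ('g \<Rightarrow> complex)" where
  "pi_op \<sigma> F f \<xi> = (\<lambda>h. \<Sum>g\<in>F. f g * Lambda \<sigma> g \<xi> h)"

definition Cr :: "('g::group_add \<Rightarrow> 'g \<Rightarrow> complex) \<Rightarrow> (('g \<Rightarrow> complex) \<Rightarrow> ('g \<Rightarrow> complex)) set" where
  "Cr \<sigma> = {T. bounded_op T \<and>
     (\<forall>\<epsilon>>0. \<exists>F f. finite F \<and> opnorm (op_diff T (pi_op \<sigma> F f)) < \<epsilon>)}"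

definition hat :: "(('g::group_add \<Rightarrow> complex) \<Rightarrow> ('g \<Rightarrow> complex)) \<Rightarrow> 'g \<Rightarrow> complex" where
  "hat x = x (\<lambda>h. if h = 0 then 1 else 0)"

definition fourier_series_conv ::
  "('g::group_add \<Rightarrow> 'g \<Rightarrow> complex) \<Rightarrow> ('g \<Rightarrow> complex) \<Rightarrow> (('g \<Rightarrow> complex) \<Rightarrow> ('g \<Rightarrow> complex))
     \<Rightarrow> (('g \<Rightarrow> complex) \<Rightarrow> ('g \<Rightarrow> complex)) \<Rightarrow> bool" where
  "fourier_series_conv \<sigma> \<phi> x S \<longleftrightarrow> bounded_op S \<and>
     (\<forall>\<epsilon>>0. \<exists>F0. finite F0 \<and> (\<forall>F. finite F \<and> F0 \<subseteq> F \<longrightarrow>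
        opnorm (op_diff S (pi_op \<sigma> F (\<lambda>g. \<phi> g * hat x g))) < \<epsilon>))"

definition MCF :: "('g::group_add \<Rightarrow> 'g \<Rightarrow> complex) \<Rightarrow> ('g \<Rightarrow> complex) set" where
  "MCF \<sigma> = {\<phi>. \<forall>x\<in>Cr \<sigma>. \<exists>S. fourier_series_conv \<sigma> \<phi> x S}"

definition Mphi ::
  "('g::group_add \<Rightarrow> 'g \<Rightarrow> complex) \<Rightarrow> ('g \<Rightarrow> complex) \<Rightarrow> (('g \<Rightarrow> complex) \<Rightarrow> ('g \<Rightarrow> complex))
     \<Rightarrow> (('g \<Rightarrow> complex) \<Rightarrow> ('g \<Rightarrow> complex))" where
  "Mphi \<sigma> \<phi> x = (SOME S. fourier_series_conv \<sigma> \<phi> x S)"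

text \<open>A net indexed by I directed along filter F: bounded Fourier summing net.\<close>
definition bounded_fourier_summing_net ::
  "('g::group_add \<Rightarrow> 'g \<Rightarrow> complex) \<Rightarrow> 'i filter \<Rightarrow> 'i set \<Rightarrow> ('i \<Rightarrow> 'g \<Rightarrow> complex) \<Rightarrow> bool" where
  "bounded_fourier_summing_net \<sigma> F I \<Phi> \<longleftrightarrow>
     (\<forall>i\<in>I. \<Phi> i \<in> MCF \<sigma>) \<and>
     (\<forall>x\<in>Cr \<sigma>. ((\<lambda>i. opnorm (op_diff (Mphi \<sigma> (\<Phi> i) x) x)) \<longlongrightarrow> 0) F) \<and>
     (\<exists>C. \<forall>i\<in>I. \<forall>x\<in>Cr \<sigma>. opnorm (Mphi \<sigma> (\<Phi> i) x) \<le> C * opnorm x)"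

definition positive_definite :: "('g::group_add \<Rightarrow> complex) \<Rightarrow> bool" where
  "positive_definite \<phi> \<longleftrightarrow> (\<forall>F c. finite F \<longrightarrow>
     (let s = (\<Sum>x\<in>F. \<Sum>y\<in>F. cnj (c x) * c y * \<phi> (- x + y)) in Im s = 0 \<and> Re s \<ge> 0))"

definition negative_definite :: "('g::group_add \<Rightarrow> real) \<Rightarrow> bool" where
  "negative_definite h \<longleftrightarrow> (\<forall>t>0. positive_definite (\<lambda>g. complex_of_real (exp (- t * h g))))"

definition haagerup_function :: "('g::group_add \<Rightarrow> real) \<Rightarrow> bool" where
  "haagerup_function h \<longleftrightarrow> (\<forall>g. h g \<ge> 0) \<and> negative_definite h \<and>
     (\<forall>t\<ge>0. finite {g. h g \<le> t})"

text \<open>Haagerup content c(E); the "insert 0" only matters for E empty (c is defined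
  in the paper only for nonempty E, where the set has an element \<ge> 1).\<close>
definition l2norm_fin :: "'g set \<Rightarrow> ('g \<Rightarrow> complex) \<Rightarrow> real" where
  "l2norm_fin E f = sqrt (\<Sum>g\<in>E. (cmod (f g))\<^sup>2)"

definition haagerup_content :: "'g::group_add set \<Rightarrow> real" where
  "haagerup_content E = Sup (insert 0
     {opnorm (pi_op (\<lambda>_ _. 1) E f) | f. l2norm_fin E f = 1})"

definition ball_L :: "('g \<Rightarrow> real) \<Rightarrow> real \<Rightarrow> 'g set" where
  "ball_L L r = {g. L g \<le> r}"

definition poly_H_growth :: "('g::group_add \<Rightarrow> real) \<Rightarrow> bool" where
  "poly_H_growth L \<longleftrightarrow> (\<exists>K>0. \<exists>p>0. \<forall>r\<ge>0.
     haagerup_content (ball_L L r) \<le> K * (1 + r) powr p)"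

definition subexp_H_growth :: "('g::group_add \<Rightarrow> real) \<Rightarrow> bool" where
  "subexp_H_growth L \<longleftrightarrow> (\<forall>b>1. \<exists>r0. \<forall>r\<ge>r0.
     haagerup_content (ball_L L r) < b powr r)"

end

theory Submission
  imports Defs
begin

text \<open>
  A real positive definite \<open>\<phi>\<close> has Gram decompositions \<open>\<phi> (h - k) = (\<Sum>j. b j h * b j k)\<close> on finite
  sets. As the matrix of \<open>M\<^sub>\<phi> x\<close> is the Schur product of \<open>\<phi> (h - k)\<close> with the matrix of \<open>x\<close>, the
  Cauchy-Schwarz inequality gives \<open>\<parallel>M\<^sub>\<phi> x\<parallel> \<le> \<phi> 0 * \<parallel>x\<parallel>\<close>. Both families in the theorem consist of such
  functions: \<open>r powr L\<close> directly, and \<open>1 / (1 + t L)\<close> as a Laplace transform of the semigroup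
  \<open>exp (- s t L)\<close>, whose powers are positive definite by the Schur product theorem. Convergence to
  the identity is then only to be checked on finite sums.

  For norm convergence of the Fourier series of \<open>M\<^sub>\<phi> x\<close>, group the terms into the annuli
  \<open>n \<le> L < n + 1\<close>: the norm of each group is at most \<open>c(B\<^bsub>n+1\<^esub>) * sup \<bar>\<phi>\<bar> * \<parallel>hat x\<parallel>\<^sub>2\<close>, and the growth
  condition makes these bounds summable.
\<close>

subsection \<open>Square-summable functions and bounded operators\<close>

lemma l2_L2_set_le:
  assumes "\<xi> \<in> l2" "finite F"
  shows "L2_set (\<lambda>g. cmod (\<xi> g)) F \<le> l2norm \<xi>"
proof -
  have "(\<Sum>g\<in>F. (cmod (\<xi> g))\<^sup>2) \<le> infsum (\<lambda>g. (cmod (\<xi> g))\<^sup>2) UNIV"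
    using assms by (intro finite_sum_le_infsum) (auto simp: l2_def)
  thus ?thesis by (simp add: L2_set_def l2norm_def)
qed

text \<open>Together with \<open>l2_L2_set_le\<close> this moves norm estimates to finite sets,
  where Minkowski and Cauchy-Schwarz for \<open>L2_set\<close> apply.\<close>

lemma l2I:
  assumes "\<And>F. finite F \<Longrightarrow> L2_set (\<lambda>g. cmod (\<xi> g)) F \<le> C"
  shows "\<xi> \<in> l2" "l2norm \<xi> \<le> C"
proof -
  have C: "0 \<le> C" using assms[of "{}"] by simp
  have le: "(\<Sum>g\<in>F. (cmod (\<xi> g))\<^sup>2) \<le> C\<^sup>2" if "finite F" for F
    using assms[OF that] real_sqrt_le_iff[of _ "C\<^sup>2"] C by (simp add: L2_set_def)
  have s: "(\<lambda>g. (cmod (\<xi> g))\<^sup>2) summable_on UNIV"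
    by (rule nonneg_bdd_above_summable_on) (auto intro!: bdd_aboveI[of _ "C\<^sup>2"] le)
  show "\<xi> \<in> l2" using s by (simp add: l2_def)
  have "infsum (\<lambda>g. (cmod (\<xi> g))\<^sup>2) UNIV \<le> C\<^sup>2"
    by (rule infsum_le_finite_sums[OF s]) (use le in auto)
  thus "l2norm \<xi> \<le> C" using C by (simp add: l2norm_def real_le_lsqrt)
qed

lemma l2norm_nonneg [simp]: "0 \<le> l2norm \<xi>"
  by (simp add: l2norm_def infsum_nonneg)

lemma cmod_le_l2norm: "\<xi> \<in> l2 \<Longrightarrow> cmod (\<xi> g) \<le> l2norm \<xi>"
  using l2_L2_set_le[of \<xi> "{g}"] by simp

lemma l2_add:
  assumes "\<xi> \<in> l2" "\<eta> \<in> l2"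
  shows "(\<lambda>g. \<xi> g + \<eta> g) \<in> l2" "l2norm (\<lambda>g. \<xi> g + \<eta> g) \<le> l2norm \<xi> + l2norm \<eta>"
proof -
  have le: "L2_set (\<lambda>g. cmod (\<xi> g + \<eta> g)) F \<le> l2norm \<xi> + l2norm \<eta>" if "finite F" for F
  proof -
    have "L2_set (\<lambda>g. cmod (\<xi> g + \<eta> g)) F \<le> L2_set (\<lambda>g. cmod (\<xi> g) + cmod (\<eta> g)) F"
      by (intro L2_set_mono) (auto intro: norm_triangle_ineq)
    also have "\<dots> \<le> L2_set (\<lambda>g. cmod (\<xi> g)) F + L2_set (\<lambda>g. cmod (\<eta> g)) F"
      by (rule L2_set_triangle_ineq)
    also have "\<dots> \<le> l2norm \<xi> + l2norm \<eta>"
      by (intro add_mono l2_L2_set_le assms that)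
    finally show ?thesis .
  qed
  show "(\<lambda>g. \<xi> g + \<eta> g) \<in> l2" "l2norm (\<lambda>g. \<xi> g + \<eta> g) \<le> l2norm \<xi> + l2norm \<eta>"
    using l2I[OF le] by auto
qed

lemma l2_scale:
  assumes "\<xi> \<in> l2"
  shows "(\<lambda>g. c * \<xi> g) \<in> l2" "l2norm (\<lambda>g. c * \<xi> g) = cmod c * l2norm \<xi>"
proof -
  have *: "(\<lambda>g. (cmod (c * \<xi> g))\<^sup>2) = (\<lambda>g. (cmod c)\<^sup>2 * (cmod (\<xi> g))\<^sup>2)"
    by (simp add: norm_mult power_mult_distrib)
  show "(\<lambda>g. c * \<xi> g) \<in> l2"
    using assms by (simp add: l2_def * summable_on_cmult_right)
  show "l2norm (\<lambda>g. c * \<xi> g) = cmod c * l2norm \<xi>"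
    by (simp add: l2norm_def * infsum_cmult_right' real_sqrt_mult)
qed

lemma l2_zero [simp]: "(\<lambda>_. 0) \<in> l2" "l2norm (\<lambda>_. 0) = 0"
  by (auto simp: l2_def l2norm_def)

lemma l2_diff:
  assumes "\<xi> \<in> l2" "\<eta> \<in> l2"
  shows "(\<lambda>g. \<xi> g - \<eta> g) \<in> l2" "l2norm (\<lambda>g. \<xi> g - \<eta> g) \<le> l2norm \<xi> + l2norm \<eta>"
  using l2_add[OF assms(1) l2_scale(1)[OF assms(2), of "-1"]] l2_scale(2)[OF assms(2), of "-1"]
  by simp_all

lemma l2_sum:
  assumes "\<And>j. j \<in> J \<Longrightarrow> \<xi> j \<in> l2"
  shows "(\<lambda>g. \<Sum>j\<in>J. \<xi> j g) \<in> l2"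
  using assms by (induction J rule: infinite_finite_induct) (auto intro: l2_add)

lemma l2norm_sum_le:
  assumes "\<And>j. j \<in> J \<Longrightarrow> \<xi> j \<in> l2"
  shows "l2norm (\<lambda>g. \<Sum>j\<in>J. \<xi> j g) \<le> (\<Sum>j\<in>J. l2norm (\<xi> j))"
  using assms
proof (induction J rule: infinite_finite_induct)
  case (insert j J)
  have "l2norm (\<lambda>g. \<xi> j g + (\<Sum>j\<in>J. \<xi> j g)) \<le> l2norm (\<xi> j) + l2norm (\<lambda>g. \<Sum>j\<in>J. \<xi> j g)"
    using insert.prems by (intro l2_add(2) l2_sum) auto
  with insert show ?case by simp
qed auto

lemma l2_mono:
  assumes "\<eta> \<in> l2" "\<And>g. cmod (\<xi> g) \<le> cmod (\<eta> g)"
  shows "\<xi> \<in> l2" "l2norm \<xi> \<le> l2norm \<eta>"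
proof -
  have "L2_set (\<lambda>g. cmod (\<xi> g)) F \<le> l2norm \<eta>" if "finite F" for F
    using L2_set_mono[of F "\<lambda>g. cmod (\<xi> g)" "\<lambda>g. cmod (\<eta> g)"] assms l2_L2_set_le[OF assms(1) that]
    by force
  from l2I[OF this] show "\<xi> \<in> l2" "l2norm \<xi> \<le> l2norm \<eta>" by auto
qed

lemma l2_finite_support:
  assumes "finite K" "\<And>g. g \<notin> K \<Longrightarrow> \<xi> g = 0"
  shows "\<xi> \<in> l2" "l2norm \<xi> = L2_set (\<lambda>g. cmod (\<xi> g)) K"
proof -
  have "L2_set (\<lambda>g. cmod (\<xi> g)) F \<le> L2_set (\<lambda>g. cmod (\<xi> g)) K" if "finite F" for F
  proof -
    have "(\<Sum>g\<in>F. (cmod (\<xi> g))\<^sup>2) = (\<Sum>g\<in>F \<inter> K. (cmod (\<xi> g))\<^sup>2)"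
      using that assms by (intro sum.mono_neutral_right) auto
    also have "\<dots> \<le> (\<Sum>g\<in>K. (cmod (\<xi> g))\<^sup>2)"
      using assms by (intro sum_mono2) auto
    finally show ?thesis by (simp add: L2_set_def)
  qed
  from l2I[OF this] show "\<xi> \<in> l2" "l2norm \<xi> = L2_set (\<lambda>g. cmod (\<xi> g)) K"
    using l2_L2_set_le[OF _ assms(1)] by (auto intro: antisym)
qed

text \<open>The standard orthonormal basis; \<open>T (delta k) h\<close> is the matrix entry of
  \<open>T\<close> in row \<open>h\<close> and column \<open>k\<close>.\<close>

definition delta :: "'g \<Rightarrow> 'g \<Rightarrow> complex" where
  "delta k = (\<lambda>h. if h = k then 1 else 0)"

lemma l2_delta [simp]: "delta k \<in> l2" "l2norm (delta k) = 1"
  using l2_finite_support[of "{k}" "delta k"] by (auto simp: delta_def)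

lemma hat_eq_delta: "hat x = x (delta 0)"
  by (simp add: hat_def delta_def)

lemma sum_delta: "finite K \<Longrightarrow> (\<Sum>k\<in>K. \<xi> k * delta k g) = (if g \<in> K then \<xi> g else 0)"
  by (simp add: delta_def if_distrib cong: if_cong)

text \<open>The tails of the convergent series of squares tend to zero. This density of finitely
  supported vectors lets finite matrix blocks control a bounded operator.\<close>

lemma l2_tail:
  fixes \<xi> :: "'g \<Rightarrow> complex"
  assumes "\<xi> \<in> l2" "0 < \<epsilon>"
  obtains K where "finite K" "l2norm (\<lambda>g. if g \<in> K then 0 else \<xi> g) \<le> \<epsilon>"
proof -
  let ?s = "\<lambda>g. (cmod (\<xi> g))\<^sup>2"
  have s: "?s summable_on UNIV" using assms by (simp add: l2_def)
  hence "(sum ?s \<longlongrightarrow> infsum ?s UNIV) (finite_subsets_at_top UNIV)"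
    using has_sum_def has_sum_infsum by blast
  hence "\<forall>\<^sub>F K in finite_subsets_at_top UNIV. dist (sum ?s K) (infsum ?s UNIV) < \<epsilon>\<^sup>2"
    using assms(2) by (intro tendstoD) auto
  then obtain K where K: "finite K" "dist (sum ?s K) (infsum ?s UNIV) < \<epsilon>\<^sup>2"
    by (auto simp: eventually_finite_subsets_at_top)
  let ?\<eta> = "\<lambda>g. if g \<in> K then 0 else \<xi> g"
  have "L2_set (\<lambda>g. cmod (?\<eta> g)) F \<le> \<epsilon>" if "finite F" for F
  proof -
    have "(\<Sum>g\<in>F. (cmod (?\<eta> g))\<^sup>2) + sum ?s K = sum ?s (F - K) + sum ?s K"
      using that by (intro arg_cong2[where f = "(+)"] refl sum.mono_neutral_cong_right) auto
    also have "\<dots> = sum ?s (F \<union> K)"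
      using that K(1) by (metis Un_Diff_cancel2 Diff_disjoint Int_commute finite_Diff sum.union_disjoint)
    also have "\<dots> \<le> infsum ?s UNIV"
      using that K(1) s by (intro finite_sum_le_infsum) auto
    finally have "(\<Sum>g\<in>F. (cmod (?\<eta> g))\<^sup>2) \<le> \<epsilon>\<^sup>2"
      using K(2) by (simp add: dist_real_def)
    thus ?thesis using assms(2) by (simp add: L2_set_def real_le_lsqrt sum_nonneg)
  qed
  from l2I(2)[OF this] K(1) that show ?thesis by blast
qed

section \<open>Bounded operators and the operator norm\<close>

lemma bounded_opD:
  assumes "bounded_op T" "\<xi> \<in> l2"
  shows "T \<xi> \<in> l2"
    and "T (\<lambda>g. c * \<xi> g) = (\<lambda>g. c * T \<xi> g)"
    and "\<eta> \<in> l2 \<Longrightarrow> T (\<lambda>g. \<xi> g + \<eta> g) = (\<lambda>g. T \<xi> g + T \<eta> g)"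
  using assms unfolding bounded_op_def by auto

lemma bounded_op_zero: "bounded_op T \<Longrightarrow> T (\<lambda>_. 0) = (\<lambda>_. 0)"
  using bounded_opD(2)[of T "\<lambda>_. 0" 0] by simp

lemma bounded_op_sum:
  assumes "bounded_op T" "\<And>j. j \<in> J \<Longrightarrow> \<xi> j \<in> l2"
  shows "T (\<lambda>g. \<Sum>j\<in>J. c j * \<xi> j g) = (\<lambda>h. \<Sum>j\<in>J. c j * T (\<xi> j) h)"
  using assms(2)
proof (induction J rule: infinite_finite_induct)
  case (insert j J)
  have "(\<lambda>g. \<Sum>i\<in>J. c i * \<xi> i g) \<in> l2" "(\<lambda>g. c j * \<xi> j g) \<in> l2"
    using insert.prems by (auto intro!: l2_sum l2_scale)
  with insert show ?case
    by (simp add: bounded_opD[OF assms(1)])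
qed (auto simp: bounded_op_zero[OF assms(1)])

lemma bounded_op_delta_expansion:
  assumes "bounded_op T" "finite K"
  shows "T (\<lambda>g. if g \<in> K then \<xi> g else 0) = (\<lambda>h. \<Sum>k\<in>K. \<xi> k * T (delta k) h)"
  using bounded_op_sum[OF assms(1), of K delta \<xi>] by (simp add: sum_delta[OF assms(2)])

lemma bdd_above_opnorm:
  assumes "bounded_op T"
  shows "bdd_above {l2norm (T \<xi>) | \<xi>. \<xi> \<in> l2 \<and> l2norm \<xi> \<le> 1}"
proof -
  obtain C where C: "\<And>\<xi>. \<xi> \<in> l2 \<Longrightarrow> l2norm (T \<xi>) \<le> C * l2norm \<xi>"
    using assms unfolding bounded_op_def by blast
  have "l2norm (T \<xi>) \<le> \<bar>C\<bar>" if "\<xi> \<in> l2" "l2norm \<xi> \<le> 1" for \<xi>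
  proof -
    have "C * l2norm \<xi> \<le> \<bar>C\<bar> * 1" using that by (intro mult_mono) auto
    with C[OF that(1)] show ?thesis by simp
  qed
  thus ?thesis by (auto intro!: bdd_aboveI[of _ "\<bar>C\<bar>"])
qed

lemma opnorm_nonneg:
  assumes "bounded_op T"
  shows "0 \<le> opnorm T"
proof -
  have "l2norm (T (\<lambda>_. 0)) \<le> opnorm T" unfolding opnorm_def
    by (intro cSup_upper bdd_above_opnorm[OF assms])
       (auto intro!: exI[of _ "\<lambda>_. 0"])
  thus ?thesis using l2norm_nonneg order_trans by blast
qed

lemma l2norm_le_opnorm:
  assumes "bounded_op T" "\<xi> \<in> l2"
  shows "l2norm (T \<xi>) \<le> opnorm T * l2norm \<xi>"
proof (cases "l2norm \<xi> = 0")
  case True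
  obtain C where "l2norm (T \<xi>) \<le> C * l2norm \<xi>"
    using assms unfolding bounded_op_def by blast
  with True show ?thesis by simp
next
  case False
  define c where "c = complex_of_real (1 / l2norm \<xi>)"
  have c: "cmod c = 1 / l2norm \<xi>" unfolding c_def norm_of_real by simp
  have n: "(\<lambda>g. c * \<xi> g) \<in> l2" "l2norm (\<lambda>g. c * \<xi> g) = 1"
    using l2_scale[OF assms(2), of c] False by (auto simp: c)
  have "l2norm (T (\<lambda>g. c * \<xi> g)) \<le> opnorm T" unfolding opnorm_def
    using n by (intro cSup_upper bdd_above_opnorm[OF assms(1)]) force
  also have "T (\<lambda>g. c * \<xi> g) = (\<lambda>g. c * T \<xi> g)"
    using assms by (simp add: bounded_opD)
  also have "l2norm \<dots> = l2norm (T \<xi>) / l2norm \<xi>"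
    using assms by (simp add: l2_scale bounded_opD c)
  finally show ?thesis using False by (simp add: field_simps less_le)
qed

lemma opnorm_leI:
  assumes "0 \<le> C" "\<And>\<xi>. \<xi> \<in> l2 \<Longrightarrow> l2norm (T \<xi>) \<le> C * l2norm \<xi>"
  shows "opnorm T \<le> C"
  unfolding opnorm_def
proof (rule cSup_least)
  show "{l2norm (T \<xi>) |\<xi>. \<xi> \<in> l2 \<and> l2norm \<xi> \<le> 1} \<noteq> {}"
    by (auto intro!: exI[of _ "\<lambda>_. 0"])
next
  fix y assume "y \<in> {l2norm (T \<xi>) |\<xi>. \<xi> \<in> l2 \<and> l2norm \<xi> \<le> 1}"
  then obtain \<xi> where "y = l2norm (T \<xi>)" "\<xi> \<in> l2" "l2norm \<xi> \<le> 1" by blast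
  with assms(2)[of \<xi>] mult_left_le[of "l2norm \<xi>" C] assms(1) show "y \<le> C" by simp
qed

lemma cmod_le_opnorm: "bounded_op T \<Longrightarrow> cmod (T (delta k) h) \<le> opnorm T"
  using cmod_le_l2norm[OF bounded_opD(1)[of T "delta k"], of h] l2norm_le_opnorm[of T "delta k"]
  by simp

lemma op_diff_delta: "op_diff S T (delta k) h = S (delta k) h - T (delta k) h"
  by (simp add: op_diff_def)

lemma opnorm_op_diff_commute: "opnorm (op_diff S T) = opnorm (op_diff T S)"
  unfolding opnorm_def op_diff_def l2norm_def by (simp add: norm_minus_commute)

lemma bounded_op_diff:
  assumes "bounded_op S" "bounded_op T"
  shows "bounded_op (op_diff S T)" "opnorm (op_diff S T) \<le> opnorm S + opnorm T"
proof -
  have le: "l2norm (op_diff S T \<xi>) \<le> (opnorm S + opnorm T) * l2norm \<xi>" if "\<xi> \<in> l2" for \<xi>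
    using l2_diff(2)[OF bounded_opD(1)[OF assms(1) that] bounded_opD(1)[OF assms(2) that]]
      l2norm_le_opnorm[OF assms(1) that] l2norm_le_opnorm[OF assms(2) that]
    unfolding op_diff_def by (simp add: algebra_simps)
  show "opnorm (op_diff S T) \<le> opnorm S + opnorm T"
    by (rule opnorm_leI) (auto simp: le opnorm_nonneg assms)
  show "bounded_op (op_diff S T)"
    unfolding bounded_op_def
  proof (intro conjI ballI allI)
    show "\<exists>C. \<forall>\<xi>\<in>l2. l2norm (op_diff S T \<xi>) \<le> C * l2norm \<xi>" using le by blast
  qed (auto simp: op_diff_def bounded_opD assms l2_diff algebra_simps fun_eq_iff)
qed

lemma opnorm_triangle:
  assumes "bounded_op S" "bounded_op T"  "bounded_op U"
  shows "opnorm (op_diff S U) \<le> opnorm (op_diff S T) + opnorm (op_diff T U)"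
proof (rule opnorm_leI)
  show "0 \<le> opnorm (op_diff S T) + opnorm (op_diff T U)"
    by (simp add: assms bounded_op_diff opnorm_nonneg)
  fix \<xi> :: "'a \<Rightarrow> complex" assume \<xi>: "\<xi> \<in> l2"
  have "op_diff S U \<xi> = (\<lambda>h. op_diff S T \<xi> h + op_diff T U \<xi> h)" by (simp add: op_diff_def)
  thus "l2norm (op_diff S U \<xi>) \<le> (opnorm (op_diff S T) + opnorm (op_diff T U)) * l2norm \<xi>"
    using l2_add(2)[of "op_diff S T \<xi>" "op_diff T U \<xi>"]
      l2norm_le_opnorm[OF bounded_op_diff(1)[OF assms(1,2)] \<xi>]
      l2norm_le_opnorm[OF bounded_op_diff(1)[OF assms(2,3)] \<xi>]
    by (simp add: bounded_opD(1) bounded_op_diff \<xi> assms algebra_simps)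
qed

text \<open>A vector is cut to a finite set \<open>K\<close>. The bound on finite blocks of the
  matrix handles the piece on \<open>K\<close>, and the known boundedness of \<open>S\<close> makes
  the image of the remainder small.\<close>

lemma opnorm_le_finite:
  assumes S: "bounded_op S" and C: "0 \<le> C"
    and le: "\<And>H K \<xi>. finite H \<Longrightarrow> finite K \<Longrightarrow>
      L2_set (\<lambda>h. cmod (\<Sum>k\<in>K. \<xi> k * S (delta k) h)) H \<le> C * L2_set (\<lambda>k. cmod (\<xi> k)) K"
  shows "opnorm S \<le> C"
proof (rule opnorm_leI[OF C], rule l2I(2))
  fix \<xi> :: "'a \<Rightarrow> complex" and H :: "'a set" assume \<xi>: "\<xi> \<in> l2" and H: "finite H"
  show "L2_set (\<lambda>g. cmod (S \<xi> g)) H \<le> C * l2norm \<xi>"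
  proof (rule field_le_epsilon)
    fix e :: real assume e: "0 < e"
    \<comment> \<open>Adding 1 keeps the quotient \<open>e / (opnorm S + 1)\<close> meaningful when
      \<open>S\<close> has norm zero.\<close>
    have pos: "0 < opnorm S + 1" using opnorm_nonneg[OF S] by simp
    obtain K where K: "finite K" "l2norm (\<lambda>g. if g \<in> K then 0 else \<xi> g) \<le> e / (opnorm S + 1)"
      using l2_tail[OF \<xi>, of "e / (opnorm S + 1)"] e pos by auto
    let ?a = "\<lambda>g. if g \<in> K then \<xi> g else 0" and ?b = "\<lambda>g. if g \<in> K then 0 else \<xi> g"
    have l2: "?a \<in> l2" "?b \<in> l2" using \<xi> by (auto intro: l2_mono)
    have "\<xi> = (\<lambda>g. ?a g + ?b g)" by auto
    hence *: "S \<xi> = (\<lambda>h. S ?a h + S ?b h)" using bounded_opD(3)[OF S l2] by simp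
    have "L2_set (\<lambda>g. cmod (S \<xi> g)) H \<le> L2_set (\<lambda>g. cmod (S ?a g) + cmod (S ?b g)) H"
      unfolding * by (intro L2_set_mono) (auto intro: norm_triangle_ineq)
    also have "\<dots> \<le> L2_set (\<lambda>g. cmod (S ?a g)) H + L2_set (\<lambda>g. cmod (S ?b g)) H"
      by (rule L2_set_triangle_ineq)
    also have "L2_set (\<lambda>g. cmod (S ?a g)) H \<le> C * L2_set (\<lambda>k. cmod (\<xi> k)) K"
      using le[OF H K(1), of \<xi>] by (simp add: bounded_op_delta_expansion[OF S K(1)])
    also have "\<dots> \<le> C * l2norm \<xi>"
      by (intro mult_left_mono l2_L2_set_le \<xi> K C)
    also have "L2_set (\<lambda>g. cmod (S ?b g)) H \<le> opnorm S * l2norm ?b"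
      using l2_L2_set_le[OF bounded_opD(1)[OF S l2(2)] H] l2norm_le_opnorm[OF S l2(2)] by simp
    also have "\<dots> \<le> (opnorm S + 1) * (e / (opnorm S + 1))"
      by (intro mult_mono K) (use opnorm_nonneg[OF S] in auto)
    also have "\<dots> = e" using pos by simp
    finally show "L2_set (\<lambda>g. cmod (S \<xi> g)) H \<le> C * l2norm \<xi> + e" by simp
  qed
qed

subsection \<open>Positive definite functions\<close>

text \<open>Induction on \<open>F\<close>, eliminating one row at a time as in a Cholesky
  factorization: either the diagonal entry of \<open>a\<close> vanishes and its whole row with it,
  or the Schur complement of that entry is again positive semidefinite.\<close>

lemma gram_decomposition:
  fixes A :: "'a \<Rightarrow> 'a \<Rightarrow> real"
  assumes "finite F" "\<And>x y. x \<in> F \<Longrightarrow> y \<in> F \<Longrightarrow> A x y = A y x"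
    and "\<And>c. 0 \<le> (\<Sum>x\<in>F. \<Sum>y\<in>F. c x * c y * A x y)"
  shows "\<exists>b. \<forall>x\<in>F. \<forall>y\<in>F. A x y = (\<Sum>j\<in>F. b j x * b j y)"
  using assms
proof (induction F arbitrary: A rule: finite_induct)
  case (insert a F)
  have sym: "A x y = A y x" if "x \<in> insert a F" "y \<in> insert a F" for x y
    using insert.prems(1) that by blast
  have quad: "(\<Sum>x\<in>insert a F. \<Sum>y\<in>insert a F. c x * c y * A x y)
      = (c a)\<^sup>2 * A a a + 2 * c a * (\<Sum>y\<in>F. c y * A a y) + (\<Sum>x\<in>F. \<Sum>y\<in>F. c x * c y * A x y)" for c
  proof -
    have "(\<Sum>x\<in>F. c x * c a * A x a) = (\<Sum>y\<in>F. c a * (c y * A a y))"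
      by (intro sum.cong refl) (simp add: sym[of _ a])
    thus ?thesis using insert.hyps
      by (simp add: sum.distrib sum_distrib_left power2_eq_square algebra_simps)
  qed
  show ?case
  proof (cases "A a a = 0")
    case True
    have zero: "A a x = 0" if "x \<in> F" for x
    proof (rule ccontr)
      assume nz: "A a x \<noteq> 0"
      \<comment> \<open>This \<open>t\<close> solves \<open>2 * t * A a x + A x x = - 1\<close>, the
        value of the form on the vector with entry \<open>t\<close> at \<open>a\<close> and 1 at
        \<open>x\<close>.\<close>
      define t where "t = - (A x x + 1) / (2 * A a x)"
      let ?c = "\<lambda>y. if y = a then t else if y = x then 1 else 0"
      have xa: "x \<noteq> a" using insert.hyps that by auto
      have pick: "(\<Sum>y\<in>F. ?c y * f y) = f x" for f :: "'a \<Rightarrow> real"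
      proof -
        have "(\<Sum>y\<in>F. ?c y * f y) = (\<Sum>y\<in>F. if y = x then f y else 0)"
          using insert.hyps by (intro sum.cong) auto
        thus ?thesis using insert.hyps that by simp
      qed
      have dbl: "(\<Sum>u\<in>F. \<Sum>y\<in>F. ?c u * ?c y * A u y) = A x x"
      proof -
        have "(\<Sum>y\<in>F. ?c u * ?c y * A u y) = ?c u * A u x" for u
          using pick[of "A u"] by (simp only: mult.assoc flip: sum_distrib_left)
        thus ?thesis using pick[of "\<lambda>u. A u x"] by (simp only:)
      qed
      have "0 \<le> 2 * t * A a x + A x x"
        using insert.prems(2)[of ?c] quad[of ?c] True pick[of "A a"] dbl by simp
      also have "2 * t * A a x = - (A x x + 1)" using nz by (simp add: t_def)
      finally show False by simp
    qed
    have "0 \<le> (\<Sum>x\<in>F. \<Sum>y\<in>F. c x * c y * A x y)" for c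
    proof -
      have "(\<Sum>x\<in>F. \<Sum>y\<in>F. (c(a := 0)) x * (c(a := 0)) y * A x y) = (\<Sum>x\<in>F. \<Sum>y\<in>F. c x * c y * A x y)"
        using insert.hyps by (intro sum.cong) auto
      thus ?thesis using insert.prems(2)[of "c(a := 0)"] quad[of "c(a := 0)"] by simp
    qed
    then obtain b where b: "\<forall>x\<in>F. \<forall>y\<in>F. A x y = (\<Sum>j\<in>F. b j x * b j y)"
      using insert.IH[of A] sym by blast
    \<comment> \<open>The row of \<open>a\<close> is zero, so the factorization over
      \<open>F\<close> is padded by zeros, in the new coordinate as well as in the new
      summand.\<close>
    let ?b = "\<lambda>j x. if j = a \<or> x = a then 0 else b j x"
    have "A x y = (\<Sum>j\<in>insert a F. ?b j x * ?b j y)"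
      if "x \<in> insert a F" "y \<in> insert a F" for x y
    proof (cases "x = a \<or> y = a")
      case True
      have "A x y = 0" using True that zero sym \<open>A a a = 0\<close> by (metis insertE)
      with True show ?thesis by auto
    next
      case False
      hence "(\<Sum>j\<in>insert a F. ?b j x * ?b j y) = (\<Sum>j\<in>F. b j x * b j y)"
        using insert.hyps by (simp, intro sum.cong) auto
      with False b that show ?thesis by simp
    qed
    thus ?thesis by (intro exI[of _ ?b] ballI)
  next
    case False
    have "0 \<le> A a a"
    proof -
      define c :: "'a \<Rightarrow> real" where "c = (\<lambda>y. if y = a then 1 else 0)"
      have c: "c a = 1" "\<And>y. y \<in> F \<Longrightarrow> c y = 0" using insert.hyps by (auto simp: c_def)
      have "(\<Sum>y\<in>F. c y * A a y) = 0" "(\<Sum>x\<in>F. \<Sum>y\<in>F. c x * c y * A x y) = 0"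
        by (simp_all add: c)
      thus ?thesis using insert.prems(2)[of c] unfolding quad c by simp
    qed
    with False have pos: "0 < A a a" by simp
    \<comment> \<open>The Schur complement of \<open>A a a\<close>: subtracting the rank-one part
      clears the row and the column of \<open>a\<close>.\<close>
    define A' where "A' x y = A x y - A a x * A a y / A a a" for x y
    have "0 \<le> (\<Sum>x\<in>F. \<Sum>y\<in>F. c x * c y * A' x y)" for c
    proof -
      define s where "s = (\<Sum>y\<in>F. c y * A a y)"
      \<comment> \<open>This value at \<open>a\<close> minimizes the form in that variable; the
        minimum is the form of \<open>A'\<close> at \<open>c\<close>.\<close>
      let ?c = "c(a := - s / A a a)"
      have 1: "(\<Sum>y\<in>F. ?c y * A a y) = s"
        unfolding s_def using insert.hyps by (intro sum.cong) auto
      have 2: "(\<Sum>x\<in>F. \<Sum>y\<in>F. ?c x * ?c y * A x y) = (\<Sum>x\<in>F. \<Sum>y\<in>F. c x * c y * A x y)"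
        using insert.hyps by (intro sum.cong) auto
      have 3: "(\<Sum>x\<in>F. \<Sum>y\<in>F. c x * c y * (A a x * A a y / A a a)) = s\<^sup>2 / A a a"
        unfolding s_def power2_eq_square sum_product sum_divide_distrib
        by (intro sum.cong refl) (simp add: algebra_simps)
      have "0 \<le> (s / A a a)\<^sup>2 * A a a - 2 * (s / A a a) * s + (\<Sum>x\<in>F. \<Sum>y\<in>F. c x * c y * A x y)"
        using insert.prems(2)[of ?c] quad[of ?c] unfolding 1 2 by simp
      also have "(s / A a a)\<^sup>2 * A a a - 2 * (s / A a a) * s = - (s\<^sup>2 / A a a)"
        using pos by (simp add: power2_eq_square field_simps)
      also have "- (s\<^sup>2 / A a a) + (\<Sum>x\<in>F. \<Sum>y\<in>F. c x * c y * A x y) = (\<Sum>x\<in>F. \<Sum>y\<in>F. c x * c y * A' x y)"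
        unfolding A'_def right_diff_distrib sum_subtractf 3 by simp
      finally show ?thesis .
    qed
    moreover have "A' x y = A' y x" if "x \<in> F" "y \<in> F" for x y
      using sym[of x y] that by (simp add: A'_def)
    ultimately obtain b where b: "\<forall>x\<in>F. \<forall>y\<in>F. A' x y = (\<Sum>j\<in>F. b j x * b j y)"
      using insert.IH[of A'] by blast
    \<comment> \<open>The summand \<open>j = a\<close> reproduces the rank-one part
      \<open>A a x * A a y / A a a\<close>; the others factor \<open>A'\<close> and vanish at
      \<open>a\<close>, as \<open>A'\<close> does.\<close>
    let ?b = "\<lambda>j x. if j = a then A a x / sqrt (A a a) else if x = a then 0 else b j x"
    have "A x y = (\<Sum>j\<in>insert a F. ?b j x * ?b j y)"
      if "x \<in> insert a F" "y \<in> insert a F" for x y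
    proof -
      have "(\<Sum>j\<in>F. ?b j x * ?b j y) = (\<Sum>j\<in>F. if x = a \<or> y = a then 0 else b j x * b j y)"
        using insert.hyps by (intro sum.cong) auto
      also have "\<dots> = (if x = a \<or> y = a then 0 else A' x y)"
        using that b by auto
      also have "\<dots> = A' x y"
        using pos that sym by (auto simp: A'_def)
      finally have "(\<Sum>j\<in>insert a F. ?b j x * ?b j y) = A a x * A a y / A a a + A' x y"
        using insert.hyps pos by simp
      thus ?thesis by (simp add: A'_def)
    qed
    thus ?thesis by (intro exI[of _ ?b] ballI)
  qed
qed auto

text \<open>Real-valued, even and positive definite, with the kernel \<open>\<phi> (x - y)\<close> of left
  multiplication operators, rather than \<open>\<phi> (- x + y)\<close> as in \<^const>\<open>positive_definite\<close>.\<close>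
definition pd_real :: "('g::group_add \<Rightarrow> real) \<Rightarrow> bool" where
  "pd_real \<phi> \<longleftrightarrow> (\<forall>x. \<phi> (- x) = \<phi> x) \<and>
     (\<forall>F c. finite F \<longrightarrow> 0 \<le> (\<Sum>x\<in>F. \<Sum>y\<in>F. c x * c y * \<phi> (x - y)))"

lemma pd_realD:
  assumes "pd_real \<phi>"
  shows "\<phi> (- x) = \<phi> x" "finite F \<Longrightarrow> 0 \<le> (\<Sum>x\<in>F. \<Sum>y\<in>F. c x * c y * \<phi> (x - y))"
  using assms unfolding pd_real_def by blast+

lemma pd_real_gram:
  assumes "pd_real \<phi>" "finite F"
  obtains b where "\<And>x y. x \<in> F \<Longrightarrow> y \<in> F \<Longrightarrow> \<phi> (x - y) = (\<Sum>j\<in>F. b j x * b j y)"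
proof -
  have "\<phi> (x - y) = \<phi> (y - x)" for x y
    using pd_realD(1)[OF assms(1), of "x - y"] by simp
  with gram_decomposition[of F "\<lambda>x y. \<phi> (x - y)"] pd_realD(2)[OF assms(1)] assms(2) that
  show ?thesis by blast
qed

text \<open>Schur product theorem: a Gram decomposition of \<open>\<phi>\<close> turns the form of
  the product into a sum over \<open>j\<close> of forms of \<open>\<psi>\<close> with weights
  \<open>c x * b j x\<close>.\<close>

lemma pd_real_mult:
  assumes "pd_real \<phi>" "pd_real \<psi>"
  shows "pd_real (\<lambda>g. \<phi> g * \<psi> g)"
  unfolding pd_real_def
proof (intro conjI allI impI)
  fix F :: "'a set" and c :: "'a \<Rightarrow> real" assume F: "finite F"
  obtain b where b: "\<And>x y. x \<in> F \<Longrightarrow> y \<in> F \<Longrightarrow> \<phi> (x - y) = (\<Sum>j\<in>F. b j x * b j y)"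
    using pd_real_gram[OF assms(1) F] by blast
  have "(\<Sum>x\<in>F. \<Sum>y\<in>F. c x * c y * (\<phi> (x - y) * \<psi> (x - y)))
      = (\<Sum>x\<in>F. \<Sum>y\<in>F. \<Sum>j\<in>F. (c x * b j x) * (c y * b j y) * \<psi> (x - y))"
    by (intro sum.cong refl) (simp add: b sum_distrib_left sum_distrib_right algebra_simps)
  also have "\<dots> = (\<Sum>x\<in>F. \<Sum>j\<in>F. \<Sum>y\<in>F. (c x * b j x) * (c y * b j y) * \<psi> (x - y))"
    by (intro sum.cong refl sum.swap)
  also have "\<dots> = (\<Sum>j\<in>F. \<Sum>x\<in>F. \<Sum>y\<in>F. (c x * b j x) * (c y * b j y) * \<psi> (x - y))"
    by (rule sum.swap)
  also have "0 \<le> \<dots>"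
    by (intro sum_nonneg pd_realD(2)[OF assms(2) F])
  finally show "0 \<le> (\<Sum>x\<in>F. \<Sum>y\<in>F. c x * c y * (\<phi> (x - y) * \<psi> (x - y)))" .
qed (simp add: pd_realD(1)[OF assms(1)] pd_realD(1)[OF assms(2)])

lemma pd_real_one: "pd_real (\<lambda>_. 1)"
proof -
  have "(\<Sum>x\<in>F. \<Sum>y\<in>F. c x * c y) = (\<Sum>x\<in>F. c x)\<^sup>2" for F and c :: "'a \<Rightarrow> real"
    by (simp add: power2_eq_square sum_product)
  thus ?thesis by (simp add: pd_real_def)
qed

lemma pd_real_power: "pd_real \<phi> \<Longrightarrow> pd_real (\<lambda>g. \<phi> g ^ n)"
  by (induction n) (auto intro: pd_real_mult pd_real_one)

lemma positive_definite_imp_pd_real: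
  fixes \<phi> :: "'g::group_add \<Rightarrow> real"
  assumes "positive_definite (\<lambda>g. complex_of_real (\<phi> g))"
  shows "pd_real \<phi>"
  unfolding pd_real_def
proof (intro conjI allI impI)
  have pd: "Im (\<Sum>x\<in>F. \<Sum>y\<in>F. cnj (c x) * c y * complex_of_real (\<phi> (- x + y))) = 0"
    "0 \<le> Re (\<Sum>x\<in>F. \<Sum>y\<in>F. cnj (c x) * c y * complex_of_real (\<phi> (- x + y)))" if "finite F" for F c
    using assms that unfolding positive_definite_def Let_def by blast+
  show "\<phi> (- x) = \<phi> x" for x
  proof (cases "x = 0")
    case False
    \<comment> \<open>On this test vector the form has imaginary part
      \<open>\<phi> x - \<phi> (- x)\<close>.\<close>
    show ?thesis
      using pd(1)[of "{0, x}" "\<lambda>y. if y = 0 then 1 else \<i>"] False by simp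
  qed simp
  fix F :: "'g set" and c :: "'g \<Rightarrow> real" assume F: "finite F"
  \<comment> \<open>Replacing \<open>x\<close> and \<open>y\<close> by their inverses turns the
    kernel \<open>\<phi> (- x + y)\<close> into \<open>\<phi> (x - y)\<close>.\<close>
  have inj: "inj_on uminus F" by simp
  have "0 \<le> Re (\<Sum>x\<in>uminus ` F. \<Sum>y\<in>uminus ` F.
      cnj (complex_of_real (c (- x))) * complex_of_real (c (- y)) * complex_of_real (\<phi> (- x + y)))"
    using F by (intro pd(2)) auto
  thus "0 \<le> (\<Sum>x\<in>F. \<Sum>y\<in>F. c x * c y * \<phi> (x - y))"
    by (simp add: sum.reindex[OF inj])
qed

lemma pd_real_exp:
  assumes "negative_definite L" "0 < t"
  shows "pd_real (\<lambda>g. exp (- t * L g))"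
  using assms unfolding negative_definite_def by (intro positive_definite_imp_pd_real) blast

text \<open>The exponential is injective, so evenness passes from \<open>exp (- L g)\<close> to
  \<open>L\<close>.\<close>

lemma negative_definite_even:
  assumes "negative_definite L"
  shows "L (- g) = L g"
  using pd_realD(1)[OF pd_real_exp[OF assms, of 1], of g] by simp

text \<open>By \<open>1 / (1 + t x) = (\<integral>s\<ge>0. exp (- s) * exp (- s t x))\<close>.\<close>
lemma pd_real_resolvent:
  fixes L :: "'g::group_add \<Rightarrow> real"
  assumes nd: "negative_definite L" and L: "\<And>g. 0 \<le> L g" and t: "0 < t"
  shows "pd_real (\<lambda>g. inverse (1 + t * L g))"
  unfolding pd_real_def
proof (intro conjI allI impI)
  fix F :: "'g set" and c :: "'g \<Rightarrow> real" assume F: "finite F"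
  have "((\<lambda>s. \<Sum>x\<in>F. \<Sum>y\<in>F. c x * c y * exp (- (1 + t * L (x - y)) * s)) has_integral
      (\<Sum>x\<in>F. \<Sum>y\<in>F. c x * c y * inverse (1 + t * L (x - y)))) {0..}"
  proof (intro has_integral_sum F has_integral_mult_right)
    fix x y
    have "0 < 1 + t * L (x - y)" using t L[of "x - y"] by (simp add: add_pos_nonneg)
    from has_integral_exp_minus_to_infinity[OF this, of 0]
    show "((\<lambda>s. exp (- (1 + t * L (x - y)) * s)) has_integral inverse (1 + t * L (x - y))) {0..}"
      by (simp add: field_simps)
  qed
  moreover have "0 \<le> (\<Sum>x\<in>F. \<Sum>y\<in>F. c x * c y * exp (- (1 + t * L (x - y)) * s))" if "s \<in> {0..}" for s
  proof -
    have pd: "pd_real (\<lambda>g. exp (- (s * t) * L g))"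
    \<comment> \<open>Negative definiteness speaks only of positive times; at \<open>s = 0\<close>
      the function is constantly 1.\<close>
    proof (cases "s = 0")
      case False
      with that t show ?thesis by (intro pd_real_exp nd) auto
    qed (simp add: pd_real_one)
    \<comment> \<open>The factor \<open>exp (- s)\<close> does not depend on \<open>x\<close> and
      \<open>y\<close>, so for each \<open>s\<close> the form is a positive multiple of that of
      \<open>exp (- (s * t) * L g)\<close>.\<close>
    have "(\<Sum>x\<in>F. \<Sum>y\<in>F. c x * c y * exp (- (1 + t * L (x - y)) * s))
        = exp (- s) * (\<Sum>x\<in>F. \<Sum>y\<in>F. c x * c y * exp (- (s * t) * L (x - y)))"
      unfolding sum_distrib_left
      by (intro sum.cong refl) (simp add: exp_add [symmetric] exp_diff algebra_simps exp_minus field_simps)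
    with pd_realD(2)[OF pd F] show ?thesis by simp
  qed
  ultimately show "0 \<le> (\<Sum>x\<in>F. \<Sum>y\<in>F. c x * c y * inverse (1 + t * L (x - y)))"
    by (rule has_integral_nonneg)
qed (simp add: negative_definite_even[OF nd])

subsection \<open>Twisted convolution operators\<close>

lemma cocycle_cmod [simp]: "normalized_2cocycle \<sigma> \<Longrightarrow> cmod (\<sigma> g h) = 1"
  and cocycle_zero [simp]: "normalized_2cocycle \<sigma> \<Longrightarrow> \<sigma> g 0 = 1"
  by (auto simp: normalized_2cocycle_def)

lemma trivial_cocycle [simp]: "normalized_2cocycle (\<lambda>_ _. 1)"
  by (simp add: normalized_2cocycle_def)

text \<open>Up to unimodular factors \<open>Lambda \<sigma> g\<close> is a translation, so its
  finite square sums are those of \<open>\<xi>\<close> over a translated set.\<close>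

lemma l2_Lambda:
  assumes \<sigma>: "normalized_2cocycle \<sigma>" and \<xi>: "\<xi> \<in> l2"
  shows "Lambda \<sigma> g \<xi> \<in> l2" "l2norm (Lambda \<sigma> g \<xi>) \<le> l2norm \<xi>"
proof -
  have "L2_set (\<lambda>h. cmod (Lambda \<sigma> g \<xi> h)) H \<le> l2norm \<xi>" if "finite H" for H
  proof -
    have "L2_set (\<lambda>h. cmod (Lambda \<sigma> g \<xi> h)) H = L2_set (\<lambda>h. cmod (\<xi> h)) ((+) (- g) ` H)"
      using \<sigma> by (simp add: L2_set_def Lambda_def norm_mult sum.reindex)
    with l2_L2_set_le[OF \<xi>, of "(+) (- g) ` H"] that show ?thesis by simp
  qed
  from l2I[OF this] show "Lambda \<sigma> g \<xi> \<in> l2" "l2norm (Lambda \<sigma> g \<xi>) \<le> l2norm \<xi>" by auto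
qed

lemma l2norm_pi_op_le:
  assumes \<sigma>: "normalized_2cocycle \<sigma>" and \<xi>: "\<xi> \<in> l2"
  shows "pi_op \<sigma> F f \<xi> \<in> l2" "l2norm (pi_op \<sigma> F f \<xi>) \<le> (\<Sum>g\<in>F. cmod (f g)) * l2norm \<xi>"
proof -
  show "pi_op \<sigma> F f \<xi> \<in> l2"
    unfolding pi_op_def by (intro l2_sum l2_scale l2_Lambda assms)
  show "l2norm (pi_op \<sigma> F f \<xi>) \<le> (\<Sum>g\<in>F. cmod (f g)) * l2norm \<xi>"
  proof (induction F rule: infinite_finite_induct)
    case (insert g F)
    have 1: "(\<lambda>h. f g * Lambda \<sigma> g \<xi> h) \<in> l2"
      by (intro l2_scale l2_Lambda assms)
    have 2: "(\<lambda>h. \<Sum>g\<in>F. f g * Lambda \<sigma> g \<xi> h) \<in> l2"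
      by (intro l2_sum l2_scale l2_Lambda assms)
    have "l2norm (\<lambda>h. f g * Lambda \<sigma> g \<xi> h) = cmod (f g) * l2norm (Lambda \<sigma> g \<xi>)"
      by (intro l2_scale l2_Lambda assms)
    also have "\<dots> \<le> cmod (f g) * l2norm \<xi>"
      by (intro mult_left_mono l2_Lambda assms) auto
    finally show ?case
      using l2_add(2)[OF 1 2] insert by (simp add: pi_op_def distrib_right)
  qed (auto simp: pi_op_def)
qed

text \<open>The crude l1 bound makes the supremum in the Haagerup content finite, and it controls
  changes of the coefficients on a fixed finite set.\<close>

lemma bounded_pi_op:
  assumes \<sigma>: "normalized_2cocycle \<sigma>"
  shows "bounded_op (pi_op \<sigma> F f)" "opnorm (pi_op \<sigma> F f) \<le> (\<Sum>g\<in>F. cmod (f g))"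
proof -
  show "bounded_op (pi_op \<sigma> F f)"
    unfolding bounded_op_def
  proof (intro conjI ballI allI)
    show "\<exists>C. \<forall>\<xi>\<in>l2. l2norm (pi_op \<sigma> F f \<xi>) \<le> C * l2norm \<xi>"
      using l2norm_pi_op_le(2)[OF \<sigma>] by blast
  qed (auto simp: l2norm_pi_op_le(1)[OF \<sigma>], auto simp: pi_op_def Lambda_def fun_eq_iff distrib_left sum.distrib
        sum_distrib_left mult.left_commute)
  show "opnorm (pi_op \<sigma> F f) \<le> (\<Sum>g\<in>F. cmod (f g))"
    by (intro opnorm_leI l2norm_pi_op_le \<sigma> sum_nonneg) auto
qed

lemma pi_op_delta:
  assumes "finite F"
  shows "pi_op \<sigma> F f (delta k) h = (if h - k \<in> F then f (h - k) * \<sigma> (h - k) k else 0)"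
proof -
  \<comment> \<open>In multiplicative notation, \<open>g^-1 h = k\<close> means
    \<open>g = h k^-1\<close>; the group need not be commutative, so the order matters.\<close>
  have eq: "- g + h = k \<longleftrightarrow> g = h - k" for g
    by (metis add_diff_cancel diff_add_cancel minus_add_cancel add_minus_cancel)
  have "pi_op \<sigma> F f (delta k) h = (\<Sum>g\<in>F. if g = h - k then f g * \<sigma> g (- g + h) else 0)"
    unfolding pi_op_def Lambda_def delta_def eq by (intro sum.cong) auto
  also have "\<dots> = (if h - k \<in> F then f (h - k) * \<sigma> (h - k) k else 0)"
    using assms eq[of "h - k"] by simp
  finally show ?thesis .
qed

lemma op_diff_pi_op: "op_diff (pi_op \<sigma> F u) (pi_op \<sigma> F v) = pi_op \<sigma> F (\<lambda>g. u g - v g)"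
  by (simp add: op_diff_def pi_op_def fun_eq_iff sum_subtractf left_diff_distrib)

section \<open>The Haagerup content as an operator bound\<close>

lemma haagerup_content_upper:
  fixes E :: "'g::group_add set"
  assumes E: "finite E"
  shows "0 \<le> haagerup_content E"
    "l2norm_fin E f = 1 \<Longrightarrow> opnorm (pi_op (\<lambda>_ _. 1) E f) \<le> haagerup_content E"
proof -
  let ?S = "{opnorm (pi_op (\<lambda>_ _. 1) E f) | f. l2norm_fin E f = 1}"
  \<comment> \<open>The set must be bounded for its \<open>Sup\<close> to be an upper bound: the
    entries of a unit vector have modulus at most 1, so the l1 bound is at most
    \<open>card E\<close>.\<close>
  have "opnorm (pi_op (\<lambda>_ _. 1) E f) \<le> card E" if "l2norm_fin E f = 1" for f
  proof -
    have "cmod (f g) \<le> 1" if "g \<in> E" for g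
      using member_le_L2_set[OF E that, of "\<lambda>g. cmod (f g)"] \<open>l2norm_fin E f = 1\<close>
      by (simp add: l2norm_fin_def L2_set_def)
    hence "(\<Sum>g\<in>E. cmod (f g)) \<le> (\<Sum>g\<in>E. 1)" by (intro sum_mono)
    with bounded_pi_op(2)[of "\<lambda>_ _. 1" E f] show ?thesis by simp
  qed
  hence bdd: "bdd_above (insert 0 ?S)" by (auto intro!: bdd_aboveI[of _ "real (card E)"])
  show "0 \<le> haagerup_content E"
    unfolding haagerup_content_def by (rule cSup_upper[OF _ bdd]) simp
  show "opnorm (pi_op (\<lambda>_ _. 1) E f) \<le> haagerup_content E" if "l2norm_fin E f = 1"
    unfolding haagerup_content_def by (rule cSup_upper[OF _ bdd]) (use that in blast)
qed

lemma l2norm_pi_op_le_content: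
  fixes E :: "'g::group_add set"
  assumes E: "finite E" and \<xi>: "\<xi> \<in> l2"
  shows "l2norm (pi_op (\<lambda>_ _. 1) E f \<xi>) \<le> haagerup_content E * l2norm_fin E f * l2norm \<xi>"
proof (cases "l2norm_fin E f = 0")
  case True
  hence "f g = 0" if "g \<in> E" for g
    using that E by (simp add: l2norm_fin_def sum_nonneg_eq_0_iff)
  hence "pi_op (\<lambda>_ _. 1) E f \<xi> = (\<lambda>_. 0)" by (simp add: pi_op_def)
  with True show ?thesis by simp
next
  case False
  define n where "n = l2norm_fin E f"
  have n: "0 < n" using False by (simp add: n_def l2norm_fin_def sum_nonneg less_le)
  let ?f = "\<lambda>g. f g / complex_of_real n"
  have "l2norm_fin E ?f = 1"
    using n by (simp add: l2norm_fin_def norm_divide power_divide real_sqrt_divide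
        flip: sum_divide_distrib) (simp add: n_def l2norm_fin_def)
  hence "l2norm (pi_op (\<lambda>_ _. 1) E ?f \<xi>) \<le> haagerup_content E * l2norm \<xi>"
    using l2norm_le_opnorm[OF bounded_pi_op(1)[OF trivial_cocycle] \<xi>, of E ?f]
      mult_right_mono[OF haagerup_content_upper(2)[OF E], of ?f "l2norm \<xi>"] by simp
  moreover have "pi_op (\<lambda>_ _. 1) E f \<xi> = (\<lambda>h. complex_of_real n * pi_op (\<lambda>_ _. 1) E ?f \<xi> h)"
    using n by (simp add: pi_op_def sum_distrib_left fun_eq_iff)
  ultimately show ?thesis
    using n by (simp add: l2_scale l2norm_pi_op_le \<xi> mult_ac flip: n_def)
qed

text \<open>Pointwise, \<open>|\<pi>\<^sub>\<sigma>(f) \<xi>| \<le> \<pi>\<^sub>\<lambda>(|f|) |\<xi>|\<close>; hence the twist does not increase the content.\<close>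
lemma opnorm_pi_op_le_content:
  fixes E :: "'g::group_add set"
  assumes \<sigma>: "normalized_2cocycle \<sigma>" and E: "finite E" "F \<subseteq> E"
  shows "opnorm (pi_op \<sigma> F f) \<le> haagerup_content E * l2norm_fin F f"
proof (rule opnorm_leI)
  show "0 \<le> haagerup_content E * l2norm_fin F f"
    using haagerup_content_upper(1)[OF E(1)] by (simp add: l2norm_fin_def sum_nonneg)
  fix \<xi> :: "'g \<Rightarrow> complex" assume \<xi>: "\<xi> \<in> l2"
  let ?\<xi> = "\<lambda>h. complex_of_real (cmod (\<xi> h))"
  \<comment> \<open>The absolute values are extended by zero from \<open>F\<close> to
    \<open>E\<close>, since the content of \<open>E\<close> is a supremum over functions on all of
    \<open>E\<close>.\<close>
  let ?f = "\<lambda>g. complex_of_real (if g \<in> F then cmod (f g) else 0)"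
  have \<xi>': "?\<xi> \<in> l2" "l2norm ?\<xi> = l2norm \<xi>"
    using \<xi> by (auto simp: l2_def l2norm_def)
  have "l2norm (pi_op \<sigma> F f \<xi>) \<le> l2norm (pi_op (\<lambda>_ _. 1) E ?f ?\<xi>)"
  proof (rule l2_mono(2))
    fix h
    have "cmod (pi_op \<sigma> F f \<xi> h) \<le> (\<Sum>g\<in>F. cmod (f g) * cmod (\<xi> (- g + h)))"
      unfolding pi_op_def Lambda_def using \<sigma> by (intro sum_norm_le) (simp add: norm_mult)
    also have "\<dots> = (\<Sum>g\<in>E. (if g \<in> F then cmod (f g) else 0) * cmod (\<xi> (- g + h)))"
      using E by (intro sum.mono_neutral_cong_left) auto
    also have "\<dots> \<le> cmod (complex_of_real \<dots>)"
      unfolding norm_of_real by simp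
    also have "complex_of_real (\<Sum>g\<in>E. (if g \<in> F then cmod (f g) else 0) * cmod (\<xi> (- g + h)))
        = pi_op (\<lambda>_ _. 1) E ?f ?\<xi> h"
      by (simp add: pi_op_def Lambda_def)
    finally show "cmod (pi_op \<sigma> F f \<xi> h) \<le> cmod (pi_op (\<lambda>_ _. 1) E ?f ?\<xi> h)" .
  qed (simp add: l2norm_pi_op_le \<xi>')
  also have "\<dots> \<le> haagerup_content E * l2norm_fin E ?f * l2norm ?\<xi>"
    by (rule l2norm_pi_op_le_content[OF E(1) \<xi>'(1)])
  also have "l2norm_fin E ?f = l2norm_fin F f"
    unfolding l2norm_fin_def using E by (intro arg_cong[where f = sqrt] sum.mono_neutral_cong_right) auto
  finally show "l2norm (pi_op \<sigma> F f \<xi>) \<le> haagerup_content E * l2norm_fin F f * l2norm \<xi>"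
    by (simp add: \<xi>')
qed

subsection \<open>Multipliers\<close>

text \<open>With a Gram decomposition \<open>\<phi> (h - k) = (\<Sum>j. b j h * b j k)\<close>, the vector on the left is
  \<open>(\<Sum>j. b j * T (b j * \<xi>))\<close>, to which Cauchy-Schwarz in \<open>j\<close> applies.\<close>
lemma schur_multiplier_bound:
  fixes T :: "('g::group_add \<Rightarrow> complex) \<Rightarrow> ('g \<Rightarrow> complex)"
  assumes \<phi>: "pd_real \<phi>" and T: "bounded_op T" and fin: "finite H" "finite K"
  shows "L2_set (\<lambda>h. cmod (\<Sum>k\<in>K. \<xi> k * (\<phi> (h - k) * T (delta k) h))) H
      \<le> \<phi> 0 * opnorm T * L2_set (\<lambda>k. cmod (\<xi> k)) K"
proof -
  define J where "J = H \<union> K"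
  have J: "finite J" using fin by (simp add: J_def)
  obtain b where b: "\<And>x y. x \<in> J \<Longrightarrow> y \<in> J \<Longrightarrow> \<phi> (x - y) = (\<Sum>j\<in>J. b j x * b j y)"
    using pd_real_gram[OF \<phi> J] by blast
  \<comment> \<open>The Gram vectors have squared norm \<open>\<phi> 0\<close>. This is used once
    for the rows and once for the columns, each time giving a factor \<open>\<phi> 0\<close> in the
    squared estimate.\<close>
  have diag: "(\<Sum>j\<in>J. (b j x)\<^sup>2) = \<phi> 0" if "x \<in> J" for x
    using b[OF that that] by (simp add: power2_eq_square)
  have \<phi>0: "0 \<le> \<phi> 0" using pd_realD(2)[OF \<phi>, of "{0}" "\<lambda>_. 1"] by simp
  define w where "w j k = (if k \<in> K then complex_of_real (b j k) * \<xi> k else 0)" for j k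
  have w: "w j \<in> l2" "l2norm (w j) = L2_set (\<lambda>k. cmod (w j k)) K" for j
    using l2_finite_support[OF fin(2), of "w j"] by (auto simp: w_def)
  have Tw: "T (w j) h = (\<Sum>k\<in>K. complex_of_real (b j k) * \<xi> k * T (delta k) h)" for j h
    unfolding w_def by (simp add: bounded_op_delta_expansion[OF T fin(2)])
  \<comment> \<open>Cauchy-Schwarz over \<open>j\<close>, with the row vector of the
    \<open>b j h\<close> as one factor.\<close>
  have pt: "(cmod (\<Sum>k\<in>K. \<xi> k * (\<phi> (h - k) * T (delta k) h)))\<^sup>2 \<le> \<phi> 0 * (\<Sum>j\<in>J. (cmod (T (w j) h))\<^sup>2)"
    if h: "h \<in> H" for h
  proof -
    have "(\<Sum>k\<in>K. \<xi> k * (\<phi> (h - k) * T (delta k) h))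
        = (\<Sum>k\<in>K. \<Sum>j\<in>J. complex_of_real (b j h) * (complex_of_real (b j k) * \<xi> k * T (delta k) h))"
      using h by (intro sum.cong refl)
        (simp add: b J_def sum_distrib_left sum_distrib_right mult_ac)
    also have "\<dots> = (\<Sum>j\<in>J. complex_of_real (b j h) * T (w j) h)"
      unfolding Tw sum_distrib_left by (rule sum.swap)
    finally have "cmod (\<Sum>k\<in>K. \<xi> k * (\<phi> (h - k) * T (delta k) h))
        = cmod (\<Sum>j\<in>J. complex_of_real (b j h) * T (w j) h)"
      by (rule arg_cong)
    also have "\<dots> \<le> (\<Sum>j\<in>J. \<bar>b j h\<bar> * \<bar>cmod (T (w j) h)\<bar>)"
      by (rule sum_norm_le) (simp add: norm_mult)
    also have "\<dots> \<le> L2_set (\<lambda>j. b j h) J * L2_set (\<lambda>j. cmod (T (w j) h)) J"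
      by (rule L2_set_mult_ineq)
    also have "\<dots> = sqrt (\<phi> 0 * (\<Sum>j\<in>J. (cmod (T (w j) h))\<^sup>2))"
      using diag[of h] h by (simp add: L2_set_def J_def real_sqrt_mult)
    finally show ?thesis
      by (intro sqrt_ge_absD) simp
  qed
  have "(\<Sum>h\<in>H. (cmod (\<Sum>k\<in>K. \<xi> k * (\<phi> (h - k) * T (delta k) h)))\<^sup>2)
      \<le> (\<Sum>h\<in>H. \<phi> 0 * (\<Sum>j\<in>J. (cmod (T (w j) h))\<^sup>2))"
    by (intro sum_mono pt)
  also have "\<dots> = \<phi> 0 * (\<Sum>j\<in>J. \<Sum>h\<in>H. (cmod (T (w j) h))\<^sup>2)"
    by (simp flip: sum_distrib_left) (simp add: sum.swap[of _ J H])
  \<comment> \<open>The bound for \<open>T\<close> is applied to each vector \<open>w j\<close>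
    separately.\<close>
  also have "\<dots> \<le> \<phi> 0 * (\<Sum>j\<in>J. (opnorm T)\<^sup>2 * (\<Sum>k\<in>K. (b j k)\<^sup>2 * (cmod (\<xi> k))\<^sup>2))"
  proof (intro mult_left_mono \<phi>0 sum_mono)
    fix j
    have "L2_set (\<lambda>h. cmod (T (w j) h)) H \<le> opnorm T * L2_set (\<lambda>k. cmod (w j k)) K"
      using l2_L2_set_le[OF bounded_opD(1)[OF T w(1)] fin(1), of j] l2norm_le_opnorm[OF T w(1), of j]
      by (simp add: w(2))
    hence "(L2_set (\<lambda>h. cmod (T (w j) h)) H)\<^sup>2 \<le> (opnorm T * L2_set (\<lambda>k. cmod (w j k)) K)\<^sup>2"
      by (intro power_mono) auto
    also have "\<dots> = (opnorm T)\<^sup>2 * (\<Sum>k\<in>K. (cmod (w j k))\<^sup>2)"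
      by (simp add: L2_set_def power_mult_distrib sum_nonneg)
    also have "(\<Sum>k\<in>K. (cmod (w j k))\<^sup>2) = (\<Sum>k\<in>K. (b j k)\<^sup>2 * (cmod (\<xi> k))\<^sup>2)"
      by (intro sum.cong) (auto simp: w_def norm_mult power_mult_distrib)
    finally show "(\<Sum>h\<in>H. (cmod (T (w j) h))\<^sup>2) \<le> (opnorm T)\<^sup>2 * (\<Sum>k\<in>K. (b j k)\<^sup>2 * (cmod (\<xi> k))\<^sup>2)"
      by (simp add: L2_set_def sum_nonneg)
  qed
  also have "\<dots> = \<phi> 0 * ((opnorm T)\<^sup>2 * (\<Sum>k\<in>K. (\<Sum>j\<in>J. (b j k)\<^sup>2) * (cmod (\<xi> k))\<^sup>2))"
    by (simp add: sum_distrib_right flip: sum_distrib_left) (simp add: sum.swap[of _ K J])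
  \<comment> \<open>With the sum over \<open>j\<close> taken first, the column vectors give the
    second factor \<open>\<phi> 0\<close>.\<close>
  also have "(\<Sum>k\<in>K. (\<Sum>j\<in>J. (b j k)\<^sup>2) * (cmod (\<xi> k))\<^sup>2) = \<phi> 0 * (\<Sum>k\<in>K. (cmod (\<xi> k))\<^sup>2)"
    unfolding sum_distrib_left by (intro sum.cong refl arg_cong2[where f = "(*)"] diag) (simp add: J_def)
  also have "\<phi> 0 * ((opnorm T)\<^sup>2 * (\<phi> 0 * (\<Sum>k\<in>K. (cmod (\<xi> k))\<^sup>2)))
      = (\<phi> 0 * opnorm T * L2_set (\<lambda>k. cmod (\<xi> k)) K)\<^sup>2"
    by (simp add: L2_set_def power_mult_distrib sum_nonneg) (simp add: power2_eq_square)
  finally show ?thesis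
    unfolding L2_set_def[of _ H] using \<phi>0 opnorm_nonneg[OF T] by (intro real_le_lsqrt sum_nonneg) auto
qed

text \<open>The bounds of \<open>schur_multiplier_bound\<close> are uniform over the finite blocks
  of \<open>S\<close>, hence bound \<open>S\<close> itself.\<close>

lemma opnorm_schur_multiplier:
  assumes \<phi>: "pd_real \<phi>" and T: "bounded_op T" and S: "bounded_op S"
    and ST: "\<And>k h. S (delta k) h = complex_of_real (\<phi> (h - k)) * T (delta k) h"
  shows "opnorm S \<le> \<phi> 0 * opnorm T"
proof (rule opnorm_le_finite[OF S])
  have "0 \<le> \<phi> 0" using pd_realD(2)[OF \<phi>, of "{0}" "\<lambda>_. 1"] by simp
  thus "0 \<le> \<phi> 0 * opnorm T" using opnorm_nonneg[OF T] by simp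
qed (simp add: ST schur_multiplier_bound[OF \<phi> T])

section \<open>Fourier coefficients and a criterion for summing nets\<close>

lemma Cr_bounded: "x \<in> Cr \<sigma> \<Longrightarrow> bounded_op x"
  by (simp add: Cr_def)

lemma Cr_approx:
  assumes "x \<in> Cr \<sigma>" "0 < e"
  obtains F f where "finite F" "opnorm (op_diff x (pi_op \<sigma> F f)) < e"
  using assms unfolding Cr_def by auto

text \<open>For finite sums the entry at \<open>(h, k)\<close> is the coefficient at
  \<open>h - k\<close> times a phase. Matrix entries are continuous in the operator norm, so the
  relation passes to limits.\<close>

lemma Cr_coeff:
  assumes \<sigma>: "normalized_2cocycle \<sigma>" and x: "x \<in> Cr \<sigma>"
  shows "x (delta k) h = hat x (h - k) * \<sigma> (h - k) k"
proof -
  have "cmod (x (delta k) h - hat x (h - k) * \<sigma> (h - k) k) \<le> 0"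
  proof (rule field_le_epsilon)
    fix e :: real assume "0 < e"
    \<comment> \<open>Half of \<open>e\<close> is spent on the entry at \<open>(h, k)\<close> and
      half on the entry at \<open>(h - k, 0)\<close>.\<close>
    then obtain F f where F: "finite F" "opnorm (op_diff x (pi_op \<sigma> F f)) < e / 2"
      using Cr_approx[OF x, of "e / 2"] by auto
    let ?p = "pi_op \<sigma> F f"
    have bd: "bounded_op (op_diff x ?p)" using x \<sigma> by (intro bounded_op_diff bounded_pi_op Cr_bounded)
    have 1: "cmod (x (delta l) g - ?p (delta l) g) \<le> e / 2" for l g
      using cmod_le_opnorm[OF bd, of l g] F(2) by (simp add: op_diff_delta)
    have "?p (delta k) h = ?p (delta 0) (h - k) * \<sigma> (h - k) k"
      using F(1) \<sigma> by (simp add: pi_op_delta)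
    hence "x (delta k) h - hat x (h - k) * \<sigma> (h - k) k
      = (x (delta k) h - ?p (delta k) h) - (x (delta 0) (h - k) - ?p (delta 0) (h - k)) * \<sigma> (h - k) k"
      by (simp add: hat_eq_delta algebra_simps)
    hence "cmod (x (delta k) h - hat x (h - k) * \<sigma> (h - k) k)
      = cmod ((x (delta k) h - ?p (delta k) h) - (x (delta 0) (h - k) - ?p (delta 0) (h - k)) * \<sigma> (h - k) k)"
      by (rule arg_cong)
    also have "\<dots> \<le> cmod (x (delta k) h - ?p (delta k) h)
        + cmod (x (delta 0) (h - k) - ?p (delta 0) (h - k))"
      by (rule order_trans[OF norm_triangle_ineq4]) (simp add: norm_mult \<sigma>)
    also have "\<dots> \<le> 0 + e" using 1[of k h] 1[of 0 "h - k"] by linarith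
    finally show "cmod (x (delta k) h - hat x (h - k) * \<sigma> (h - k) k) \<le> 0 + e" .
  qed
  thus ?thesis by simp
qed

lemma fourier_series_conv_coeff:
  assumes \<sigma>: "normalized_2cocycle \<sigma>" and S: "fourier_series_conv \<sigma> \<phi> x S"
  shows "S (delta k) h = \<phi> (h - k) * hat x (h - k) * \<sigma> (h - k) k"
proof -
  have "cmod (S (delta k) h - \<phi> (h - k) * hat x (h - k) * \<sigma> (h - k) k) \<le> 0"
  proof (rule field_le_epsilon)
    fix e :: real assume "0 < e"
    with S obtain F0 where F0: "finite F0" "\<And>F. finite F \<Longrightarrow> F0 \<subseteq> F \<Longrightarrow>
        opnorm (op_diff S (pi_op \<sigma> F (\<lambda>g. \<phi> g * hat x g))) < e"
      unfolding fourier_series_conv_def by meson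
    \<comment> \<open>Once \<open>h - k\<close> lies in the index set, the entry of the partial sum
      already has its limiting value.\<close>
    let ?F = "insert (h - k) F0"
    let ?p = "pi_op \<sigma> ?F (\<lambda>g. \<phi> g * hat x g)"
    have bd: "bounded_op (op_diff S ?p)"
      using S \<sigma> unfolding fourier_series_conv_def by (intro bounded_op_diff bounded_pi_op) auto
    have "cmod (S (delta k) h - ?p (delta k) h) \<le> e"
      using cmod_le_opnorm[OF bd, of k h] F0(2)[of ?F] F0(1) by (force simp: op_diff_delta)
    thus "cmod (S (delta k) h - \<phi> (h - k) * hat x (h - k) * \<sigma> (h - k) k) \<le> 0 + e"
      using F0(1) by (simp add: pi_op_delta)
  qed
  thus ?thesis by simp
qed

text \<open>\<^const>\<open>Mphi\<close> is a Hilbert choice; membership in \<^const>\<open>MCF\<close> makes it meaningful.\<close>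
lemma Mphi_conv:
  assumes "\<phi> \<in> MCF \<sigma>" "x \<in> Cr \<sigma>"
  shows "fourier_series_conv \<sigma> \<phi> x (Mphi \<sigma> \<phi> x)"
  using assms unfolding MCF_def Mphi_def by (metis (mono_tags, lifting) mem_Collect_eq someI_ex)

text \<open>Positive definite functions with value at most 1 at the identity give contractive
  multipliers. Contractivity supplies the uniform bound and reduces convergence to finite sums,
  where pointwise convergence of \<open>\<phi> i\<close> is enough.\<close>

lemma bounded_fourier_summing_netI:
  fixes \<phi> :: "'i \<Rightarrow> 'g::group_add \<Rightarrow> real"
  assumes \<sigma>: "normalized_2cocycle \<sigma>"
    and MCF: "\<And>i. i \<in> I \<Longrightarrow> (\<lambda>g. complex_of_real (\<phi> i g)) \<in> MCF \<sigma>"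
    and pd: "\<And>i. i \<in> I \<Longrightarrow> pd_real (\<phi> i)"
    and le1: "\<And>i. i \<in> I \<Longrightarrow> \<phi> i 0 \<le> 1"
    and lim: "\<And>g. ((\<lambda>i. \<phi> i g) \<longlongrightarrow> 1) F"
    and ev: "\<forall>\<^sub>F i in F. i \<in> I"
  shows "bounded_fourier_summing_net \<sigma> F I (\<lambda>i g. complex_of_real (\<phi> i g))"
proof -
  let ?M = "\<lambda>i. Mphi \<sigma> (\<lambda>g. complex_of_real (\<phi> i g))"
  have Mb: "bounded_op (?M i x)"
    and Mc: "?M i x (delta k) h = complex_of_real (\<phi> i (h - k)) * x (delta k) h"
    if "i \<in> I" "x \<in> Cr \<sigma>" for i x k h
    using Mphi_conv[OF MCF that(2)] that
      fourier_series_conv_coeff[OF \<sigma> Mphi_conv[OF MCF that(2)], of i k h]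
    by (auto simp: fourier_series_conv_def Cr_coeff[OF \<sigma>])
  \<comment> \<open>Stated for general \<open>S\<close> and \<open>T\<close>, as it is applied to
    \<open>x\<close> and also to the difference of \<open>x\<close> and a finite sum.\<close>
  have contr: "opnorm S \<le> opnorm T"
    if "i \<in> I" "bounded_op S" "bounded_op T"
      "\<And>k h. S (delta k) h = complex_of_real (\<phi> i (h - k)) * T (delta k) h" for i S T
    using opnorm_schur_multiplier[OF pd that(3,2,4)] that(1) le1[of i] opnorm_nonneg[OF that(3)]
      mult_right_mono[of "\<phi> i 0" 1 "opnorm T"] by fastforce
  have "((\<lambda>i. opnorm (op_diff (?M i x) x)) \<longlongrightarrow> 0) F" if x: "x \<in> Cr \<sigma>" for x
  proof (rule tendstoI)
    fix e :: real assume e: "0 < e"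
    then obtain E f where E: "finite E" "opnorm (op_diff x (pi_op \<sigma> E f)) < e / 3"
      using Cr_approx[OF x, of "e / 3"] by auto
    \<comment> \<open>\<open>?q i\<close> is the multiplier applied to the finite sum
      \<open>?p\<close>; the path from \<open>?M i x\<close> to \<open>x\<close> goes through
      \<open>?q i\<close> and \<open>?p\<close>.\<close>
    let ?p = "pi_op \<sigma> E f" and ?q = "\<lambda>i. pi_op \<sigma> E (\<lambda>g. complex_of_real (\<phi> i g) * f g)"
    have pb: "bounded_op (pi_op \<sigma> E u)" for u by (intro bounded_pi_op \<sigma>)
    have "((\<lambda>i. \<Sum>g\<in>E. cmod (complex_of_real (\<phi> i g) * f g - f g)) \<longlongrightarrow>
        (\<Sum>g\<in>E. cmod (complex_of_real 1 * f g - f g))) F"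
      by (intro tendsto_intros lim)
    hence "\<forall>\<^sub>F i in F. (\<Sum>g\<in>E. cmod (complex_of_real (\<phi> i g) * f g - f g)) < e / 3"
      using e by (intro order_tendstoD) auto
    with ev show "\<forall>\<^sub>F i in F. dist (opnorm (op_diff (?M i x) x)) 0 < e"
    proof eventually_elim
      case (elim i)
      have "opnorm (op_diff (?M i x) (?q i)) \<le> opnorm (op_diff x ?p)"
        by (rule contr[OF elim(1)])
          (auto intro!: bounded_op_diff pb Mb Cr_bounded[OF x] x elim
            simp: op_diff_delta Mc elim x pi_op_delta[OF E(1)] algebra_simps)
      moreover have "opnorm (op_diff (?q i) ?p) < e / 3"
        unfolding op_diff_pi_op using bounded_pi_op(2)[OF \<sigma>] elim(2) by (rule le_less_trans)
      moreover have "opnorm (op_diff (?M i x) x)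
          \<le> opnorm (op_diff (?M i x) (?q i)) + (opnorm (op_diff (?q i) ?p) + opnorm (op_diff ?p x))"
        using opnorm_triangle[OF Mb[OF elim(1) x] pb[of "\<lambda>g. complex_of_real (\<phi> i g) * f g"] Cr_bounded[OF x]]
          opnorm_triangle[OF pb[of "\<lambda>g. complex_of_real (\<phi> i g) * f g"] pb[of f] Cr_bounded[OF x]] by linarith
      ultimately have "opnorm (op_diff (?M i x) x) < e"
        using E(2) opnorm_op_diff_commute[of x ?p] by simp
      moreover have "0 \<le> opnorm (op_diff (?M i x) x)"
        by (intro opnorm_nonneg bounded_op_diff Mb Cr_bounded[OF x] x elim)
      ultimately show ?case by simp
    qed
  qed
  moreover have "opnorm (?M i x) \<le> 1 * opnorm x" if "i \<in> I" "x \<in> Cr \<sigma>" for i x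
    using contr[OF that(1) Mb[OF that] Cr_bounded[OF that(2)] Mc[OF that]] by simp
  ultimately show ?thesis
    unfolding bounded_fourier_summing_net_def using MCF by blast
qed

section \<open>Norm convergence of multiplied Fourier series\<close>

lemma summable_convolution:
  fixes u \<xi> :: "'g::group_add \<Rightarrow> complex"
  assumes \<sigma>: "normalized_2cocycle \<sigma>" and u: "u \<in> l2" and \<xi>: "\<xi> \<in> l2"
  shows "(\<lambda>g. u g * Lambda \<sigma> g \<xi> h) summable_on UNIV"
proof -
  \<comment> \<open>For fixed \<open>h\<close> this map permutes the group, so square-summability of
    \<open>\<xi>\<close> carries over to its translate.\<close>
  have "bij (\<lambda>g. - g + h)"
    by (rule bij_betw_byWitness[where f' = "\<lambda>k. h - k"])
      (auto simp: diff_add_eq_diff_diff_swap)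
  from summable_on_reindex_bij_betw[OF this, of "\<lambda>k. (cmod (\<xi> k))\<^sup>2"]
  have "(\<lambda>g. (cmod (u g))\<^sup>2 + (cmod (\<xi> (- g + h)))\<^sup>2) summable_on UNIV"
    using u \<xi> by (intro summable_on_add) (auto simp: l2_def)
  \<comment> \<open>The arithmetic-geometric mean inequality dominates the terms, so the convolution
    converges absolutely at every point.\<close>
  moreover have "norm (u g * Lambda \<sigma> g \<xi> h) \<le> (cmod (u g))\<^sup>2 + (cmod (\<xi> (- g + h)))\<^sup>2" for g
  proof -
    have "2 * cmod (u g) * cmod (\<xi> (- g + h)) \<le> (cmod (u g))\<^sup>2 + (cmod (\<xi> (- g + h)))\<^sup>2"
      by (rule sum_squares_bound)
    moreover have "0 \<le> cmod (u g) * cmod (\<xi> (- g + h))" by simp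
    ultimately have "cmod (u g) * cmod (\<xi> (- g + h)) \<le> (cmod (u g))\<^sup>2 + (cmod (\<xi> (- g + h)))\<^sup>2"
      by linarith
    thus ?thesis using \<sigma> by (simp add: Lambda_def norm_mult)
  qed
  ultimately have "(\<lambda>g. norm (u g * Lambda \<sigma> g \<xi> h)) summable_on UNIV"
    by (rule summable_on_comparison_test) auto
  thus ?thesis by (rule abs_summable_summable)
qed

lemma hat_l2: "x \<in> Cr \<sigma> \<Longrightarrow> hat x \<in> l2"
  by (simp add: hat_eq_delta Cr_bounded bounded_opD(1))

text \<open>The norms of the partial Fourier sums over the annuli \<open>n \<le> L < n + 1\<close> are
  summable; the limit operator is convolution by the whole series.\<close>
lemma MCF_criterion:
  fixes L \<phi> :: "'g::group_add \<Rightarrow> real"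
  assumes \<sigma>: "normalized_2cocycle \<sigma>"
    and fin: "\<And>r. finite (ball_L L r)" and L: "\<And>g. 0 \<le> L g"
    and a: "\<And>n. 0 \<le> a n" and le1: "\<And>g. \<bar>\<phi> g\<bar> \<le> 1"
    and dom: "\<And>g n. real n \<le> L g \<Longrightarrow> \<bar>\<phi> g\<bar> \<le> a n"
    and sm: "summable (\<lambda>n. haagerup_content (ball_L L (real n + 1)) * a n)"
  shows "(\<lambda>g. complex_of_real (\<phi> g)) \<in> MCF \<sigma>"
  unfolding MCF_def
proof (intro CollectI ballI)
  fix x assume x: "x \<in> Cr \<sigma>"
  define N where "N = l2norm (hat x)"
  define u where "u g = complex_of_real (\<phi> g) * hat x g" for g
  \<comment> \<open>The index of the annulus that contains \<open>g\<close>.\<close>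
  define \<nu> where "\<nu> g = nat \<lfloor>L g\<rfloor>" for g
  define c where "c n = haagerup_content (ball_L L (real n + 1)) * a n" for n
  have N: "0 \<le> N" by (simp add: N_def)
  have \<nu>: "real (\<nu> g) \<le> L g" "L g \<le> real (\<nu> g) + 1" for g
    using L[of g] unfolding \<nu>_def by linarith+
  have c: "0 \<le> c n" for n
    using haagerup_content_upper(1)[OF fin] a by (simp add: c_def)
  have u: "u \<in> l2"
    by (rule l2_mono(1)[OF hat_l2[OF x]])
      (use le1 in \<open>auto simp: u_def norm_mult intro: mult_left_le_one_le\<close>)
  \<comment> \<open>The annulus of index \<open>n\<close> lies in the ball of radius
    \<open>n + 1\<close>, which supplies the content, while \<open>n \<le> L g\<close> on it
    supplies the decay \<open>a n\<close>; hence the shift in \<open>c\<close>.\<close>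
  have shell: "opnorm (pi_op \<sigma> F u) \<le> c n * N" if F: "finite F" "\<And>g. g \<in> F \<Longrightarrow> \<nu> g = n" for F n
  proof -
    have "F \<subseteq> ball_L L (real n + 1)" using F(2) \<nu>(2) by (force simp: ball_L_def)
    hence "opnorm (pi_op \<sigma> F u) \<le> haagerup_content (ball_L L (real n + 1)) * l2norm_fin F u"
      by (intro opnorm_pi_op_le_content \<sigma> fin)
    also have "l2norm_fin F u \<le> L2_set (\<lambda>g. a n * cmod (hat x g)) F"
    proof -
      have "cmod (u g) \<le> a n * cmod (hat x g)" if "g \<in> F" for g
        using dom[of n g] \<nu>(1)[of g] F(2)[OF that] by (auto simp: u_def norm_mult intro: mult_right_mono)
      thus ?thesis unfolding l2norm_fin_def L2_set_def[symmetric] by (intro L2_set_mono) auto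
    qed
    also have "\<dots> = a n * L2_set (\<lambda>g. cmod (hat x g)) F"
      by (simp add: L2_set_right_distrib a)
    also have "\<dots> \<le> a n * N"
      unfolding N_def by (intro mult_left_mono l2_L2_set_le hat_l2[OF x] F a)
    finally show ?thesis
      using haagerup_content_upper(1)[OF fin] by (simp add: c_def mult.assoc mult_left_mono)
  qed
  \<comment> \<open>A finite set avoiding the first \<open>m\<close> annuli is split along the
    remaining ones; \<open>M\<close> bounds the indices that occur in it.\<close>
  have tail: "\<exists>M. \<forall>\<xi>\<in>l2. l2norm (pi_op \<sigma> F u \<xi>) \<le> sum c {m..<M} * N * l2norm \<xi>"
    if F: "finite F" "\<And>g. g \<in> F \<Longrightarrow> m \<le> \<nu> g" for F m
  proof -
    obtain M where M: "\<And>g. g \<in> F \<Longrightarrow> \<nu> g < M"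
      using finite_imageI[OF F(1), of \<nu>] by (auto simp: finite_nat_set_iff_bounded)
    have "l2norm (pi_op \<sigma> F u \<xi>) \<le> sum c {m..<M} * N * l2norm \<xi>" if \<xi>: "\<xi> \<in> l2" for \<xi>
    proof -
      let ?F = "\<lambda>n. {g \<in> F. \<nu> g = n}"
      have "pi_op \<sigma> F u \<xi> = (\<lambda>h. \<Sum>n\<in>{m..<M}. pi_op \<sigma> (?F n) u \<xi> h)"
        unfolding pi_op_def using F M by (intro ext sum.group[symmetric]) auto
      hence "l2norm (pi_op \<sigma> F u \<xi>) = l2norm (\<lambda>h. \<Sum>n\<in>{m..<M}. pi_op \<sigma> (?F n) u \<xi> h)"
        by (rule arg_cong)
      also have "\<dots> \<le> (\<Sum>n\<in>{m..<M}. l2norm (pi_op \<sigma> (?F n) u \<xi>))"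
        by (rule l2norm_sum_le) (rule l2norm_pi_op_le(1)[OF \<sigma> \<xi>])
      also have "\<dots> \<le> (\<Sum>n\<in>{m..<M}. c n * N * l2norm \<xi>)"
      proof (rule sum_mono)
        fix n
        have "l2norm (pi_op \<sigma> (?F n) u \<xi>) \<le> opnorm (pi_op \<sigma> (?F n) u) * l2norm \<xi>"
          by (intro l2norm_le_opnorm bounded_pi_op \<sigma> \<xi>)
        also have "\<dots> \<le> c n * N * l2norm \<xi>"
          using F(1) by (intro mult_right_mono shell) auto
        finally show "l2norm (pi_op \<sigma> (?F n) u \<xi>) \<le> c n * N * l2norm \<xi>" .
      qed
      finally show ?thesis by (simp add: sum_distrib_right)
    qed
    thus ?thesis by blast
  qed
  have cauchy: "\<exists>F0. finite F0 \<and> (\<forall>F. finite F \<and> F \<inter> F0 = {} \<longrightarrow>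
      (\<forall>\<xi>\<in>l2. l2norm (pi_op \<sigma> F u \<xi>) \<le> e * l2norm \<xi>))" if e: "0 < e" for e
  proof -
    have "summable c" using sm by (simp add: c_def[abs_def])
    \<comment> \<open>\<open>N + 1\<close> avoids a division by zero when \<open>hat x\<close>
      vanishes.\<close>
    then obtain m where m: "\<And>M. norm (sum c {m..<M}) < e / (N + 1)"
      using e N unfolding summable_Cauchy by (metis add_nonneg_pos divide_pos_pos order_refl zero_less_one)
    have "sum c {m..<M} * N \<le> e" for M
    proof -
      have "sum c {m..<M} * N \<le> e / (N + 1) * (N + 1)"
        using m[of M] N e by (intro mult_mono) auto
      thus ?thesis using N by simp
    qed
    hence le: "sum c {m..<M} * N * l2norm \<xi> \<le> e * l2norm \<xi>" for M and \<xi> :: "'g \<Rightarrow> complex"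
      by (intro mult_right_mono) auto
    \<comment> \<open>The set to be avoided is the union of the first \<open>m\<close> annuli,
      finite because it lies in a ball.\<close>
    have "{g. \<nu> g < m} \<subseteq> ball_L L (real m + 1)"
    proof
      fix g assume "g \<in> {g. \<nu> g < m}"
      hence "real (\<nu> g) < real m" by simp
      thus "g \<in> ball_L L (real m + 1)" using \<nu>(2)[of g] by (simp add: ball_L_def)
    qed
    hence fin': "finite {g. \<nu> g < m}" using fin finite_subset by blast
    have "l2norm (pi_op \<sigma> F u \<xi>) \<le> e * l2norm \<xi>"
      if F: "finite F" "F \<inter> {g. \<nu> g < m} = {}" and \<xi>: "\<xi> \<in> l2" for F \<xi>
    proof -
      have "m \<le> \<nu> g" if "g \<in> F" for g using F(2) that by (meson disjoint_iff mem_Collect_eq not_le)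
      then obtain M where "\<forall>\<xi>\<in>l2. l2norm (pi_op \<sigma> F u \<xi>) \<le> sum c {m..<M} * N * l2norm \<xi>"
        using tail[OF F(1)] by blast
      with \<xi> le show ?thesis by (meson order_trans)
    qed
    with fin' show ?thesis by blast
  qed
  \<comment> \<open>The limit is defined pointwise; norm convergence of the partial sums to it is
    then recovered from the Cauchy estimate.\<close>
  define S where "S \<xi> h = infsum (\<lambda>g. u g * Lambda \<sigma> g \<xi> h) UNIV" for \<xi> h
  have sml: "(\<lambda>g. u g * Lambda \<sigma> g \<xi> h) summable_on UNIV" if "\<xi> \<in> l2" for \<xi> h
    by (rule summable_convolution[OF \<sigma> u that])
  have conv: "\<exists>F0. finite F0 \<and> (\<forall>F. finite F \<and> F0 \<subseteq> F \<longrightarrow> (\<forall>\<xi>\<in>l2.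
      op_diff S (pi_op \<sigma> F u) \<xi> \<in> l2 \<and> l2norm (op_diff S (pi_op \<sigma> F u) \<xi>) \<le> e * l2norm \<xi>))"
    if e: "0 < e" for e
  proof -
    obtain F0 where F0: "finite F0" and F0': "\<forall>F. finite F \<and> F \<inter> F0 = {} \<longrightarrow>
        (\<forall>\<xi>\<in>l2. l2norm (pi_op \<sigma> F u \<xi>) \<le> e * l2norm \<xi>)"
      using cauchy[OF e] by (elim exE conjE)
    \<comment> \<open>The Cauchy estimate for \<open>F' - F\<close> is restricted to the finitely
      many coordinates in \<open>H\<close>, where the limit along growing \<open>F'\<close> may be
      taken termwise.\<close>
    have fatou: "L2_set (\<lambda>h. cmod (op_diff S (pi_op \<sigma> F u) \<xi> h)) H \<le> e * l2norm \<xi>"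
      if F: "finite F" "F0 \<subseteq> F" and \<xi>: "\<xi> \<in> l2" and H: "finite H" for F \<xi> H
    proof -
      have "((\<lambda>F'. pi_op \<sigma> F' u \<xi> h) \<longlongrightarrow> S \<xi> h) (finite_subsets_at_top UNIV)" for h
        using has_sum_infsum[OF sml[OF \<xi>], of h] by (simp add: has_sum_def S_def pi_op_def)
      hence lim: "((\<lambda>F'. L2_set (\<lambda>h. cmod (pi_op \<sigma> F' u \<xi> h - pi_op \<sigma> F u \<xi> h)) H)
          \<longlongrightarrow> L2_set (\<lambda>h. cmod (op_diff S (pi_op \<sigma> F u) \<xi> h)) H) (finite_subsets_at_top UNIV)"
        unfolding L2_set_def op_diff_def by (intro tendsto_intros)
      have "L2_set (\<lambda>h. cmod (pi_op \<sigma> F' u \<xi> h - pi_op \<sigma> F u \<xi> h)) H \<le> e * l2norm \<xi>"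
        if F': "finite F'" "F \<subseteq> F'" for F'
      proof -
        have "pi_op \<sigma> F' u \<xi> h - pi_op \<sigma> F u \<xi> h = pi_op \<sigma> (F' - F) u \<xi> h" for h
          unfolding pi_op_def using F' by (simp add: sum_diff)
        hence "L2_set (\<lambda>h. cmod (pi_op \<sigma> F' u \<xi> h - pi_op \<sigma> F u \<xi> h)) H \<le> l2norm (pi_op \<sigma> (F' - F) u \<xi>)"
          using l2_L2_set_le[OF l2norm_pi_op_le(1)[OF \<sigma> \<xi>] H] by simp
        also have "\<dots> \<le> e * l2norm \<xi>"
          using F F' \<xi> by (intro F0'[rule_format]) auto
        finally show ?thesis .
      qed
      hence "\<forall>\<^sub>F F' in finite_subsets_at_top UNIV.
          L2_set (\<lambda>h. cmod (pi_op \<sigma> F' u \<xi> h - pi_op \<sigma> F u \<xi> h)) H \<le> e * l2norm \<xi>"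
        unfolding eventually_finite_subsets_at_top using F(1) by (intro exI[of _ F]) simp
      thus ?thesis by (rule tendsto_upperbound[OF lim]) simp
    qed
    show ?thesis
    proof (intro exI[of _ F0] conjI allI impI ballI F0)
      fix F and \<xi> :: "'g \<Rightarrow> complex" assume F: "finite F \<and> F0 \<subseteq> F" and \<xi>: "\<xi> \<in> l2"
      note bound = fatou[OF conjunct1[OF F] conjunct2[OF F] \<xi>]
      show "op_diff S (pi_op \<sigma> F u) \<xi> \<in> l2"
        by (rule l2I(1)[of "op_diff S (pi_op \<sigma> F u) \<xi>"], rule bound)
      show "l2norm (op_diff S (pi_op \<sigma> F u) \<xi>) \<le> e * l2norm \<xi>"
        by (rule l2I(2)[of "op_diff S (pi_op \<sigma> F u) \<xi>"], rule bound)
    qed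
  qed
  have "bounded_op S"
    unfolding bounded_op_def
  proof (intro conjI ballI allI)
    \<comment> \<open>A single partial sum within distance 1 of \<open>S\<close> already makes
      \<open>S\<close> bounded.\<close>
    obtain F where F: "finite F" "\<And>\<xi>. \<xi> \<in> l2 \<Longrightarrow> op_diff S (pi_op \<sigma> F u) \<xi> \<in> l2"
      "\<And>\<xi>. \<xi> \<in> l2 \<Longrightarrow> l2norm (op_diff S (pi_op \<sigma> F u) \<xi>) \<le> 1 * l2norm \<xi>"
      using conv[of 1] by auto
    have eq: "S \<xi> = (\<lambda>h. op_diff S (pi_op \<sigma> F u) \<xi> h + pi_op \<sigma> F u \<xi> h)" for \<xi>
      by (simp add: op_diff_def)
    show "S \<xi> \<in> l2" if "\<xi> \<in> l2" for \<xi>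
      by (subst eq) (intro l2_add F l2norm_pi_op_le \<sigma> that)
    have "l2norm (S \<xi>) \<le> (1 + opnorm (pi_op \<sigma> F u)) * l2norm \<xi>" if \<xi>: "\<xi> \<in> l2" for \<xi>
      using l2_add(2)[OF F(2)[OF \<xi>] l2norm_pi_op_le(1)[OF \<sigma> \<xi>, of F u]] F(3)[OF \<xi>]
        l2norm_le_opnorm[OF bounded_pi_op(1)[OF \<sigma>] \<xi>, of F u]
      by (simp add: eq[of \<xi>, symmetric] distrib_right)
    thus "\<exists>C. \<forall>\<xi>\<in>l2. l2norm (S \<xi>) \<le> C * l2norm \<xi>" by blast
  next
    fix \<xi> \<eta> :: "'g \<Rightarrow> complex" assume "\<xi> \<in> l2" "\<eta> \<in> l2"
    hence "infsum (\<lambda>g. u g * Lambda \<sigma> g \<xi> h + u g * Lambda \<sigma> g \<eta> h) UNIV = S \<xi> h + S \<eta> h" for h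
      unfolding S_def by (intro infsum_add sml)
    moreover have "S (\<lambda>g. \<xi> g + \<eta> g) h
        = infsum (\<lambda>g. u g * Lambda \<sigma> g \<xi> h + u g * Lambda \<sigma> g \<eta> h) UNIV" for h
      unfolding S_def by (intro infsum_cong) (simp add: Lambda_def distrib_left)
    ultimately show "S (\<lambda>g. \<xi> g + \<eta> g) = (\<lambda>h. S \<xi> h + S \<eta> h)" by (simp add: fun_eq_iff)
  next
    fix \<xi> :: "'g \<Rightarrow> complex" and k assume "\<xi> \<in> l2"
    have "S (\<lambda>g. k * \<xi> g) h = k * S \<xi> h" for h
      unfolding S_def infsum_cmult_right'[symmetric] by (intro infsum_cong) (simp add: Lambda_def)
    thus "S (\<lambda>g. k * \<xi> g) = (\<lambda>h. k * S \<xi> h)" by (simp add: fun_eq_iff)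
  qed
  moreover have "\<exists>F0. finite F0 \<and> (\<forall>F. finite F \<and> F0 \<subseteq> F \<longrightarrow> opnorm (op_diff S (pi_op \<sigma> F u)) < e)"
    if "0 < e" for e
  proof -
    \<comment> \<open>Halving \<open>e\<close> turns the non-strict bound on the supremum into the
      required strict one.\<close>
    have e2: "0 < e / 2" using that by simp
    obtain F0 where F0: "finite F0" and F0': "\<forall>F. finite F \<and> F0 \<subseteq> F \<longrightarrow> (\<forall>\<xi>\<in>l2.
        op_diff S (pi_op \<sigma> F u) \<xi> \<in> l2 \<and> l2norm (op_diff S (pi_op \<sigma> F u) \<xi>) \<le> e / 2 * l2norm \<xi>)"
      using conv[OF e2] by (elim exE conjE)
    have "opnorm (op_diff S (pi_op \<sigma> F u)) < e" if F: "finite F \<and> F0 \<subseteq> F" for F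
    proof -
      have "opnorm (op_diff S (pi_op \<sigma> F u)) \<le> e / 2"
      proof (rule opnorm_leI)
        show "0 \<le> e / 2" using e2 by (rule less_imp_le)
        show "l2norm (op_diff S (pi_op \<sigma> F u) \<xi>) \<le> e / 2 * l2norm \<xi>" if "\<xi> \<in> l2" for \<xi>
          by (rule conjunct2[OF F0'[rule_format, OF F that]])
      qed
      with e2 show ?thesis by simp
    qed
    thus ?thesis by (intro exI[of _ F0] conjI F0 allI impI)
  qed
  ultimately have "fourier_series_conv \<sigma> (\<lambda>g. complex_of_real (\<phi> g)) x S"
    unfolding fourier_series_conv_def u_def[symmetric] by (intro conjI allI impI)
  thus "\<exists>S. fourier_series_conv \<sigma> (\<lambda>g. complex_of_real (\<phi> g)) x S" by (intro exI[of _ S])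
qed

section \<open>Summability from the two growth conditions\<close>

lemma summable_poly_resolvent:
  fixes c :: "nat \<Rightarrow> real"
  assumes c: "\<And>n. 0 \<le> c n" "\<And>n. c n \<le> K * (2 + real n) powr p"
    and K: "0 < K" and q: "p + 2 \<le> real q" and t: "0 < t"
  shows "summable (\<lambda>n. c n * inverse ((1 + t * real n) ^ q))"
proof -
  \<comment> \<open>From \<open>2 * m \<le> 1\<close> and \<open>m \<le> t\<close> follows
    \<open>m * (2 + n) \<le> 1 + t * n\<close>, so growth and decay are both measured in powers of
    \<open>2 + n\<close>.\<close>
  define m where "m = min (1 / 2) t"
  have m: "0 < m" "m \<le> 1 / 2" "m \<le> t" using t by (auto simp: m_def)
  have "norm (c n * inverse ((1 + t * real n) ^ q)) \<le> K / m ^ q * inverse (real (n + 2) ^ 2)" for n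
  proof -
    have pos: "0 < 1 + t * real n" using t by (simp add: add_pos_nonneg)
    have "m * (2 + real n) \<le> 1 + t * real n"
      using m mult_right_mono[OF m(3), of "real n"] by (simp add: algebra_simps)
    hence "(m * (2 + real n)) ^ q \<le> (1 + t * real n) ^ q"
      using m by (intro power_mono) auto
    hence 1: "inverse ((1 + t * real n) ^ q) \<le> inverse ((m * (2 + real n)) ^ q)"
      using m by (intro le_imp_inverse_le) auto
    \<comment> \<open>Since \<open>p + 2 \<le> q\<close>, absorbing the growth leaves two powers of
      \<open>2 + n\<close>, enough for convergence.\<close>
    have "(2 + real n) powr p * (2 + real n) ^ 2 = (2 + real n) powr (p + 2)"
      by (simp add: powr_add)
    also have "\<dots> \<le> (2 + real n) powr real q" using q by (intro powr_mono) auto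
    also have "\<dots> = (2 + real n) ^ q" by (simp add: powr_realpow)
    finally have 2: "(2 + real n) powr p * inverse ((2 + real n) ^ q) \<le> inverse ((2 + real n) ^ 2)"
      by (simp add: field_simps)
    have "norm (c n * inverse ((1 + t * real n) ^ q)) = c n * inverse ((1 + t * real n) ^ q)"
      using c(1) pos by simp
    also have "\<dots> \<le> (K * (2 + real n) powr p) * inverse ((m * (2 + real n)) ^ q)"
      using c 1 pos K by (intro mult_mono) auto
    also have "\<dots> = K / m ^ q * ((2 + real n) powr p * inverse ((2 + real n) ^ q))"
      unfolding power_mult_distrib by (simp add: field_simps)
    also have "\<dots> \<le> K / m ^ q * inverse ((2 + real n) ^ 2)"
      using K m by (intro mult_left_mono 2) auto
    finally show ?thesis by (simp add: add.commute)
  qed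
  moreover have "summable (\<lambda>n. K / m ^ q * inverse (real (n + 2) ^ 2))"
    by (intro summable_mult summable_ignore_initial_segment inverse_power_summable) simp
  ultimately show ?thesis by (rule summable_comparison_test'[where N = 0, rotated])
qed

text \<open>Half of the decay is spent: of the two factors \<open>sqrt r ^ n\<close> in
  \<open>r ^ n\<close>, one cancels the growth with base \<open>1 / sqrt r\<close> and the other
  leaves a geometric series.\<close>

lemma summable_subexp_geometric:
  fixes c :: "nat \<Rightarrow> real"
  assumes c: "\<And>n. 0 \<le> c n" and r: "0 < r" "r < 1"
    and le: "\<And>n. N \<le> n \<Longrightarrow> c n \<le> (1 / sqrt r) powr (real n + 1)"
  shows "summable (\<lambda>n. c n * r powr real n)"
proof (rule summable_comparison_test'[where N = N])
  show "summable (\<lambda>n. 1 / sqrt r * sqrt r ^ n)"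
    using r by (intro summable_mult summable_geometric) auto
  fix n assume n: "N \<le> n"
  have "norm (c n * r powr real n) = c n * r ^ n" using c r by (simp add: powr_realpow)
  also have "\<dots> \<le> (1 / sqrt r) powr (real n + 1) * r ^ n"
    using le[OF n] r by (intro mult_right_mono) auto
  also have "(1 / sqrt r) powr (real n + 1) = (1 / sqrt r) ^ Suc n"
    using r powr_realpow[of "1 / sqrt r" "Suc n"] by (simp add: add.commute)
  also have "r ^ n = sqrt r ^ n * sqrt r ^ n" using r by (simp flip: power_mult_distrib)
  also have "(1 / sqrt r) ^ Suc n * (sqrt r ^ n * sqrt r ^ n) = 1 / sqrt r * sqrt r ^ n"
    using r by (simp add: power_divide)
  finally show "norm (c n * r powr real n) \<le> 1 / sqrt r * sqrt r ^ n" .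
qed

theorem theorem5p9:
  fixes L :: "'g::{group_add, countable} \<Rightarrow> real"
  assumes "haagerup_function L"
  shows "(poly_H_growth L \<longrightarrow>
            (\<exists>q::nat. q \<ge> 1 \<and>
               (\<forall>\<sigma>. normalized_2cocycle \<sigma> \<longrightarrow>
                  bounded_fourier_summing_net \<sigma> (at_right 0) {0<..}
                    (\<lambda>t g. complex_of_real (inverse ((1 + t * L g) ^ q))))))
       \<and> (subexp_H_growth L \<longrightarrow>
            (\<forall>\<sigma>. normalized_2cocycle \<sigma> \<longrightarrow>
               bounded_fourier_summing_net \<sigma> (at_left 1) {0<..<1}
                 (\<lambda>r g. complex_of_real (r powr L g))))"
proof (intro conjI impI)
  have nd: "negative_definite L" and L: "\<And>g. 0 \<le> L g"
    using assms by (auto simp: haagerup_function_def)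
  \<comment> \<open>Properness is given for nonnegative radii; a ball of negative radius is
    empty.\<close>
  have fin: "finite (ball_L L r)" for r
  proof (cases "0 \<le> r")
    case True
    thus ?thesis using assms by (simp add: haagerup_function_def ball_L_def)
  next
    case False
    hence "ball_L L r = {}" using L by (force simp: ball_L_def intro: order_trans)
    thus ?thesis by simp
  qed
  note content = haagerup_content_upper(1)[OF fin]
  show "\<exists>q::nat. q \<ge> 1 \<and> (\<forall>\<sigma>. normalized_2cocycle \<sigma> \<longrightarrow>
      bounded_fourier_summing_net \<sigma> (at_right 0) {0<..}
        (\<lambda>t g. complex_of_real (inverse ((1 + t * L g) ^ q))))" if "poly_H_growth L"
  proof -
    from that obtain K p where K: "0 < K" "0 < p"
      "\<forall>r\<ge>0. haagerup_content (ball_L L r) \<le> K * (1 + r) powr p"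
      unfolding poly_H_growth_def by blast
    \<comment> \<open>The exponent depends only on \<open>p\<close> and is fixed before
      \<open>\<sigma>\<close>, so it serves all cocycles.\<close>
    define q where "q = nat \<lceil>p + 2\<rceil>"
    have q: "p + 2 \<le> real q" unfolding q_def by linarith
    have "bounded_fourier_summing_net \<sigma> (at_right 0) {0<..}
        (\<lambda>t g. complex_of_real (inverse ((1 + t * L g) ^ q)))" if \<sigma>: "normalized_2cocycle \<sigma>" for \<sigma>
    proof (rule bounded_fourier_summing_netI[OF \<sigma>])
      fix t :: real assume "t \<in> {0<..}"
      hence t: "0 < t" by simp
      have ge1: "1 \<le> 1 + t * L g" for g using t L by simp
      have le1: "inverse ((1 + t * L g) ^ q) \<le> 1" for g
        using ge1[of g] by (simp add: inverse_le_1_iff one_le_power)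
      show "inverse ((1 + t * L 0) ^ q) \<le> 1" by (rule le1)
      show "pd_real (\<lambda>g. inverse ((1 + t * L g) ^ q))"
        using pd_real_power[OF pd_real_resolvent[OF nd L t], of q] by (simp add: power_inverse)
      show "(\<lambda>g. complex_of_real (inverse ((1 + t * L g) ^ q))) \<in> MCF \<sigma>"
      proof (rule MCF_criterion[OF \<sigma> fin L, where a = "\<lambda>n. inverse ((1 + t * real n) ^ q)"])
        show "0 \<le> inverse ((1 + t * real n) ^ q)" for n using t by simp
        show "\<bar>inverse ((1 + t * L g) ^ q)\<bar> \<le> 1" for g
          using le1[of g] ge1[of g] by (simp add: abs_of_nonneg)
        show "\<bar>inverse ((1 + t * L g) ^ q)\<bar> \<le> inverse ((1 + t * real n) ^ q)" if "real n \<le> L g" for g n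
        proof -
          have "(1 + t * real n) ^ q \<le> (1 + t * L g) ^ q"
            using that t by (intro power_mono) (auto intro: mult_left_mono)
          moreover have "0 < (1 + t * real n) ^ q" using t by (simp add: add_pos_nonneg)
          ultimately have "inverse ((1 + t * L g) ^ q) \<le> inverse ((1 + t * real n) ^ q)"
            by (rule le_imp_inverse_le)
          thus ?thesis using ge1[of g] by (simp add: abs_of_nonneg)
        qed
        show "summable (\<lambda>n. haagerup_content (ball_L L (real n + 1)) * inverse ((1 + t * real n) ^ q))"
        proof (rule summable_poly_resolvent[OF content _ K(1) q t])
          \<comment> \<open>At radius \<open>n + 1\<close> the growth bound reads
            \<open>1 + (n + 1) = 2 + n\<close>.\<close>
          show "haagerup_content (ball_L L (real n + 1)) \<le> K * (2 + real n) powr p" for n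
            using K(3)[rule_format, of "real n + 1"] by (simp add: add.commute add.left_commute)
        qed
      qed
    next
      fix g
      have "((\<lambda>t. inverse ((1 + t * L g) ^ q)) \<longlongrightarrow> inverse ((1 + 0 * L g) ^ q)) (at_right 0)"
        by (intro tendsto_intros) auto
      thus "((\<lambda>t. inverse ((1 + t * L g) ^ q)) \<longlongrightarrow> 1) (at_right 0)" by simp
    next
      show "\<forall>\<^sub>F t in at_right 0. t \<in> {0::real<..}"
        using eventually_at_right_less[of "0::real"] by simp
    qed
    moreover have "1 \<le> q" using q K(2) by linarith
    ultimately show ?thesis by (intro exI[of _ q] conjI allI impI)
  qed
  show "\<forall>\<sigma>. normalized_2cocycle \<sigma> \<longrightarrow> bounded_fourier_summing_net \<sigma> (at_left 1) {0<..<1}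
      (\<lambda>r g. complex_of_real (r powr L g))" if sub: "subexp_H_growth L"
  proof (intro allI impI, rule bounded_fourier_summing_netI)
    fix \<sigma> :: "'g \<Rightarrow> 'g \<Rightarrow> complex" and r :: real
    assume \<sigma>: "normalized_2cocycle \<sigma>" and "r \<in> {0<..<1}"
    hence r: "0 < r" "r < 1" by auto
    have le1: "r powr L g \<le> 1" for g using r L by (intro powr_le1) auto
    show "r powr L 0 \<le> 1" by (rule le1)
    \<comment> \<open>\<open>r powr L g\<close> is \<open>exp (- t * L g)\<close> with
      \<open>t = - ln r\<close>, which is positive because \<open>r < 1\<close>.\<close>
    show "pd_real (\<lambda>g. r powr L g)"
      using pd_real_exp[OF nd, of "- ln r"] r by (simp add: powr_def mult.commute)
    show "(\<lambda>g. complex_of_real (r powr L g)) \<in> MCF \<sigma>"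
    proof (rule MCF_criterion[OF \<sigma> fin L, where a = "\<lambda>n. r powr real n"])
      \<comment> \<open>The base is chosen so that the growth uses up only the square root of the
        decay \<open>r powr real n\<close>.\<close>
      have "1 < 1 / sqrt r" using r by simp
      then obtain r0 where r0: "\<forall>s\<ge>r0. haagerup_content (ball_L L s) < (1 / sqrt r) powr s"
        using sub unfolding subexp_H_growth_def by blast
      show "summable (\<lambda>n. haagerup_content (ball_L L (real n + 1)) * r powr real n)"
      \<comment> \<open>From this index on, the radius \<open>n + 1\<close> is past
        \<open>r0\<close>, also when \<open>r0\<close> is negative.\<close>
      proof (rule summable_subexp_geometric[OF content r, where N = "nat \<lceil>r0\<rceil>"])
        show "haagerup_content (ball_L L (real n + 1)) \<le> (1 / sqrt r) powr (real n + 1)"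
          if "nat \<lceil>r0\<rceil> \<le> n" for n
          using that by (intro less_imp_le r0[rule_format]) linarith
      qed
      show "\<bar>r powr L g\<bar> \<le> r powr real n" if "real n \<le> L g" for g n
        using powr_mono'[OF that] r by simp
    qed (use le1 in simp_all)
  next
    fix g
    have "((\<lambda>r. r powr L g) \<longlongrightarrow> 1 powr L g) (at_left 1)"
      by (intro tendsto_intros) auto
    thus "((\<lambda>r. r powr L g) \<longlongrightarrow> 1) (at_left (1::real))" by simp
  next
    show "\<forall>\<^sub>F r in at_left 1. r \<in> {0::real<..<1}"
      by (rule eventually_at_leftI[of 0]) auto
  qed
qed

end
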